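(* Let $1\leq p,q\leq\infty$, $m>0$, and suppose that the differentiation operator $D:\mathcal{F}_{(m,p)}\to\mathcal{F}_{(m,q)}$, $Df=f'$, is bounded. Then the following statements are equivalent. (i) $D:\mathcal{F}_{(m,p)}\to\mathcal{F}_{(m,q)}$ has closed range; (ii) $p=q$ and $m=1$; (iii) $D:\mathcal{F}_{(m,p)}\to\mathcal{F}_{(m,q)}$ is surjective.
   Context: $\mathcal{H}(\mathbb{C})$ denotes the set of entire functions on $\mathbb{C}$ and $A$ is the Lebesgue area measure. For $m>0$ and $1\leq p<\infty$, the Fock-type space is $$\mathcal{F}_{(m,p)}=\Big\{f\in\mathcal{H}(\mathbb{C}):\ \|f\|_{(m,p)}^p=\int_{\mathbb{C}}|f(z)|^pe^{-p|z|^m}\,dA(z)<\infty\Big\},$$ and $$\mathcal{F}_{(m,\infty)}=\Big\{f\in\mathcal{H}(\mathbb{C}):\ \|f\|_{(m,\infty)}=\sup_{z\in\mathbb{C}}|f(z)|e^{-|z|^m}<\infty\Big\}.$$ "$D:\mathcal{F}_{(m,p)}\to\mathcal{F}_{(m,q)}$ is bounded" means that $f'\in\mathcal{F}_{(m,q)}$ for every $f\in\mathcal{F}_{(m,p)}$ and there is a constant $C$ with $\|f'\|_{(m,q)}\leq C\|f\|_{(m,p)}$ for all such $f$. *)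

theory Defs
  imports "HOL-Complex_Analysis.Complex_Analysis"
begin

text \<open>The quantities whose finiteness defines the spaces: \<open>fock_int m r f\<close> is the
  \<open>r\<close>-th power of the norm for a finite exponent \<open>r\<close>, \<open>fock_sup m f\<close> is the norm for the exponent
  \<open>\<infinity>\<close>. Lebesgue area measure is \<^const>\<open>lborel\<close> on the complex numbers.\<close>

definition fock_int :: "real \<Rightarrow> real \<Rightarrow> (complex \<Rightarrow> complex) \<Rightarrow> ennreal" where
  "fock_int m r f =
     (\<integral>\<^sup>+ z. ennreal (cmod (f z) powr r * exp (- (r * cmod z powr m))) \<partial>lborel)"

definition fock_sup :: "real \<Rightarrow> (complex \<Rightarrow> complex) \<Rightarrow> ennreal" where
  "fock_sup m f = (SUP z. ennreal (cmod (f z) * exp (- (cmod z powr m))))"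

definition fock_space :: "real \<Rightarrow> ennreal \<Rightarrow> (complex \<Rightarrow> complex) set" where
  "fock_space m p = {f. f holomorphic_on UNIV \<and>
     (if p = \<infinity> then fock_sup m f < \<infinity> else fock_int m (enn2real p) f < \<infinity>)}"

definition fock_norm :: "real \<Rightarrow> ennreal \<Rightarrow> (complex \<Rightarrow> complex) \<Rightarrow> real" where
  "fock_norm m p f =
     (if p = \<infinity> then enn2real (fock_sup m f)
      else enn2real (fock_int m (enn2real p) f) powr (1 / enn2real p))"

definition fock_dist ::
  "real \<Rightarrow> ennreal \<Rightarrow> (complex \<Rightarrow> complex) \<Rightarrow> (complex \<Rightarrow> complex) \<Rightarrow> real" where
  "fock_dist m p f g = fock_norm m p (\<lambda>z. f z - g z)"

text \<open>The norm topology on \<open>fock_space m p\<close>; the lemma \<open>Metric_space_fock\<close> below shows that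
  \<^const>\<open>fock_dist\<close> is a metric there when \<open>1 \<le> p\<close>.\<close>

definition fock_topology :: "real \<Rightarrow> ennreal \<Rightarrow> (complex \<Rightarrow> complex) topology" where
  "fock_topology m p = Metric_space.mtopology (fock_space m p) (fock_dist m p)"

definition D_bounded :: "real \<Rightarrow> ennreal \<Rightarrow> ennreal \<Rightarrow> bool" where
  "D_bounded m p q \<longleftrightarrow>
     (\<forall>f\<in>fock_space m p. deriv f \<in> fock_space m q) \<and>
     (\<exists>C. \<forall>f\<in>fock_space m p. fock_norm m q (deriv f) \<le> C * fock_norm m p f)"

definition D_closed_range :: "real \<Rightarrow> ennreal \<Rightarrow> ennreal \<Rightarrow> bool" where
  "D_closed_range m p q \<longleftrightarrow> closedin (fock_topology m q) (deriv ` fock_space m p)"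

definition D_surjective :: "real \<Rightarrow> ennreal \<Rightarrow> ennreal \<Rightarrow> bool" where
  "D_surjective m p q \<longleftrightarrow> deriv ` fock_space m p = fock_space m q"

lemma fock_norm_nonneg: "0 \<le> fock_norm m p f"
  by (simp add: fock_norm_def)

lemma fock_dist_commute: "fock_dist m p f g = fock_dist m p g f"
  by (simp add: fock_dist_def fock_norm_def fock_sup_def fock_int_def norm_minus_commute)

lemma fock_norm_zero: "fock_norm m p (\<lambda>z. 0) = 0"
  by (simp add: fock_norm_def fock_sup_def fock_int_def)

lemma enn2real_exponent_ge_1:
  assumes "1 \<le> p" "p \<noteq> (\<infinity>::ennreal)" shows "1 \<le> enn2real p"
  using assms by (cases p) auto

lemma measurable_fock_integrand:
  assumes "f holomorphic_on UNIV" "0 < r"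
  shows "(\<lambda>z. ennreal (cmod (f z) powr r * exp (- (r * cmod z powr m)))) \<in> borel_measurable lborel"
proof -
  have "f \<in> borel_measurable borel"
    using assms(1) by (intro borel_measurable_continuous_onI holomorphic_on_imp_continuous_on)
  then show ?thesis by measurable
qed

lemma fock_norm_eq_0D:
  assumes p: "1 \<le> p" and f: "f \<in> fock_space m p" and 0: "fock_norm m p f = 0"
  shows "f z = 0"
proof (cases "p = \<infinity>")
  case True
  have fin: "fock_sup m f < \<infinity>" using f True by (simp add: fock_space_def)
  have "enn2real (fock_sup m f) = 0" using 0 True by (simp add: fock_norm_def)
  then have "fock_sup m f = 0" using fin by (auto simp: enn2real_eq_0_iff)
  moreover have "ennreal (cmod (f z) * exp (- (cmod z powr m))) \<le> fock_sup m f"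
    unfolding fock_sup_def by (rule SUP_upper) simp
  ultimately have "cmod (f z) * exp (- (cmod z powr m)) \<le> 0"
    by (simp add: ennreal_eq_0_iff)
  then show ?thesis by (simp add: mult_le_0_iff not_le)
next
  case False
  define r where "r = enn2real p"
  have r: "1 \<le> r" using enn2real_exponent_ge_1[OF p False] by (simp add: r_def)
  have hol: "f holomorphic_on UNIV" and fin: "fock_int m r f < \<infinity>"
    using f False by (auto simp: fock_space_def r_def)
  have "enn2real (fock_int m r f) = 0" using 0 False by (simp add: fock_norm_def r_def)
  then have "fock_int m r f = 0" using fin by (auto simp: enn2real_eq_0_iff)
  then have "AE z in lborel. ennreal (cmod (f z) powr r * exp (- (r * cmod z powr m))) = 0"
    using measurable_fock_integrand[OF hol, of r m] r
    unfolding fock_int_def by (subst (asm) nn_integral_0_iff_AE) auto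
  then have "AE z in lborel. f z = 0"
    by eventually_elim (use r in \<open>auto simp: ennreal_eq_0_iff mult_le_0_iff not_le\<close>)
  then have ae: "AE z in lebesgue. f z = 0" by (rule AE_completion)
  show ?thesis
  proof (rule ccontr)
    assume "f z \<noteq> 0"
    have "open {z. f z \<noteq> 0}"
      using holomorphic_on_imp_continuous_on[OF hol]
      by (intro open_Collect_neq) (auto intro: continuous_intros)
    moreover have "negligible {z. f z \<noteq> 0}"
      using ae by (simp add: eventually_ae_filter negligible_iff_null_sets)
        (metis (lifting) null_sets_completion_subset)
    ultimately show False
      using \<open>f z \<noteq> 0\<close> open_not_negligible by blast
  qed
qed

lemma fock_minkowski_pointwise:
  fixes a b u v r :: real
  assumes "0 < a" "0 < b" "0 \<le> u" "0 \<le> v" "1 \<le> r"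
  shows "(u + v) powr r \<le> (a + b) powr (r - 1) * (a powr (1 - r) * u powr r + b powr (1 - r) * v powr r)"
proof -
  have conv: "(s * x + t * y) powr r \<le> s * x powr r + t * y powr r"
    if "0 \<le> x" "0 \<le> y" "0 < s" "0 < t" "s + t = 1" for s t x y :: real
  proof -
    have pw: "c powr r \<le> c" if "0 < c" "c \<le> 1" for c
      using powr_mono'[of 1 r c] that assms(5) by simp
    show ?thesis
    proof (cases "x = 0 \<or> y = 0")
      case True
      have one: "(c * w) powr r \<le> c * w powr r" if "0 < c" "c \<le> 1" "0 \<le> w" for c w
        using mult_right_mono[OF pw[OF that(1,2)], of "w powr r"] that by (simp add: powr_mult)
      have "s \<le> 1" "t \<le> 1" using that by linarith+
      with True one[of s x] one[of t y] that assms(5) show ?thesis by (elim disjE) simp_all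
    next
      case False
      then show ?thesis
        using convex_onD[OF powr_convex[OF assms(5)], of t x y] that
        by (simp add: eq_diff_eq[symmetric])
    qed
  qed
  have ab: "0 < a + b" using assms by simp
  define s t where "s = a / (a + b)" and "t = b / (a + b)"
  have st: "0 < s" "0 < t" "s + t = 1"
    using assms ab by (auto simp: s_def t_def add_divide_distrib[symmetric])
  have "u + v = (a + b) * (s * (u / a) + t * (v / b))"
  proof -
    have "s * (u / a) = u / (a + b)" "t * (v / b) = v / (a + b)"
      using assms ab by (simp_all add: s_def t_def)
    then show ?thesis using ab by (simp flip: add_divide_distrib)
  qed
  also have "\<dots> powr r = (a + b) powr r * (s * (u / a) + t * (v / b)) powr r"
    using assms st ab by (intro powr_mult)
  also have "\<dots> \<le> (a + b) powr r * (s * (u / a) powr r + t * (v / b) powr r)"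
    using conv[of "u / a" "v / b" s t] st assms by (intro mult_left_mono) auto
  also have "\<dots> = (a + b) powr (r - 1) * (a powr (1 - r) * u powr r + b powr (1 - r) * v powr r)"
  proof -
    have "(a + b) powr r * (x / (a + b) * (w / x) powr r)
        = (a + b) powr (r - 1) * (x powr (1 - r) * w powr r)" if "0 < x" "0 \<le> w" for x w
      using that ab by (simp add: powr_divide powr_diff)
    from this[of a u] this[of b v] show ?thesis
      using assms by (simp add: s_def t_def distrib_left)
  qed
  finally show ?thesis .
qed

lemma fock_norm_add:
  assumes p: "1 \<le> p" and f: "f \<in> fock_space m p" and g: "g \<in> fock_space m p"
  shows "(\<lambda>z. f z + g z) \<in> fock_space m p"
    and "fock_norm m p (\<lambda>z. f z + g z) \<le> fock_norm m p f + fock_norm m p g"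
proof -
  have hf: "f holomorphic_on UNIV" and hg: "g holomorphic_on UNIV"
    using f g by (auto simp: fock_space_def)
  then have hfg: "(\<lambda>z. f z + g z) holomorphic_on UNIV" by (intro holomorphic_intros)
  have "(\<lambda>z. f z + g z) \<in> fock_space m p \<and>
    fock_norm m p (\<lambda>z. f z + g z) \<le> fock_norm m p f + fock_norm m p g"
  proof (cases "p = \<infinity>")
    case True
    have fin: "fock_sup m f < top" "fock_sup m g < top"
      using f g True by (auto simp: fock_space_def)
    have le: "fock_sup m (\<lambda>z. f z + g z) \<le> fock_sup m f + fock_sup m g"
      unfolding fock_sup_def
    proof (rule SUP_least)
      fix z
      have "ennreal (cmod (f z + g z) * exp (- (cmod z powr m)))
        \<le> ennreal (cmod (f z) * exp (- (cmod z powr m)) + cmod (g z) * exp (- (cmod z powr m)))"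
        by (intro ennreal_leI) (simp add: norm_triangle_ineq mult_right_mono flip: distrib_right)
      also have "\<dots> = ennreal (cmod (f z) * exp (- (cmod z powr m)))
          + ennreal (cmod (g z) * exp (- (cmod z powr m)))"
        by (simp add: ennreal_plus)
      also have "\<dots> \<le> (SUP z. ennreal (cmod (f z) * exp (- (cmod z powr m))))
          + (SUP z. ennreal (cmod (g z) * exp (- (cmod z powr m))))"
        by (intro add_mono SUP_upper) auto
      finally show "ennreal (cmod (f z + g z) * exp (- (cmod z powr m))) \<le> \<dots>" .
    qed
    have "fock_sup m f + fock_sup m g < top" using fin by simp
    then have "fock_sup m (\<lambda>z. f z + g z) < top" using le by (rule le_less_trans[rotated])
    moreover have "enn2real (fock_sup m (\<lambda>z. f z + g z))
        \<le> enn2real (fock_sup m f) + enn2real (fock_sup m g)"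
      using enn2real_mono[OF le] fin by (simp add: enn2real_plus)
    ultimately show ?thesis using True hfg by (simp add: fock_space_def fock_norm_def)
  next
    case False
    define r where "r = enn2real p"
    have r: "1 \<le> r" using enn2real_exponent_ge_1[OF p False] by (simp add: r_def)
    define a b where "a = fock_norm m p f" and "b = fock_norm m p g"
    show ?thesis
    proof (cases "a = 0 \<or> b = 0")
      case True
      then have "(\<lambda>z. f z) = (\<lambda>z. 0) \<or> (\<lambda>z. g z) = (\<lambda>z. 0)"
        using fock_norm_eq_0D[OF p f] fock_norm_eq_0D[OF p g] by (auto simp: a_def b_def)
      then show ?thesis using f g fock_norm_nonneg by (auto simp: fock_norm_zero)
    next
      case nz: False
      then have a: "0 < a" and b: "0 < b"
        using fock_norm_nonneg[of m p f] fock_norm_nonneg[of m p g] by (auto simp: a_def b_def)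
      have ff: "fock_int m r f = ennreal (a powr r)" and fg: "fock_int m r g = ennreal (b powr r)"
        using f g False r
        by (auto simp: fock_space_def fock_norm_def a_def b_def powr_powr simp flip: r_def)
      define c d where "c = (a + b) powr (r - 1) * a powr (1 - r)"
        and "d = (a + b) powr (r - 1) * b powr (1 - r)"
      have pos: "0 \<le> c" "0 \<le> d" by (auto simp: c_def d_def)
      let ?F = "\<lambda>h z. cmod (h z) powr r * exp (- (r * cmod z powr m))"
      have F: "cmod u powr r * exp (- (r * cmod z powr m)) = (cmod u * exp (- (cmod z powr m))) powr r"
        for u z
        by (simp add: powr_mult exp_powr_real mult.commute[of _ r])
      have pt: "?F (\<lambda>z. f z + g z) z \<le> c * ?F f z + d * ?F g z" for z
      proof -
        let ?w = "exp (- (cmod z powr m))"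
        have "?F (\<lambda>z. f z + g z) z \<le> (cmod (f z) * ?w + cmod (g z) * ?w) powr r"
        proof -
          have "cmod (f z + g z) * ?w \<le> cmod (f z) * ?w + cmod (g z) * ?w"
            using mult_right_mono[OF norm_triangle_ineq[of "f z" "g z"], of ?w]
            by (simp only: distrib_right exp_ge_zero)
          then show ?thesis unfolding F using r by (intro powr_mono2) simp_all
        qed
        also have "\<dots> \<le> c * ?F f z + d * ?F g z"
          unfolding F c_def d_def mult.assoc distrib_left[symmetric]
          using r by (intro fock_minkowski_pointwise[OF a b]) simp_all
        finally show ?thesis .
      qed
      have mf: "(\<lambda>z. ennreal (?F f z)) \<in> borel_measurable lborel"
        and mg: "(\<lambda>z. ennreal (?F g z)) \<in> borel_measurable lborel"
        using measurable_fock_integrand[OF hf, of r m] measurable_fock_integrand[OF hg, of r m] r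
        by auto
      have "fock_int m r (\<lambda>z. f z + g z)
          \<le> (\<integral>\<^sup>+ z. ennreal c * ennreal (?F f z) + ennreal d * ennreal (?F g z) \<partial>lborel)"
        unfolding fock_int_def
      proof (rule nn_integral_mono)
        fix z
        have "ennreal (?F (\<lambda>z. f z + g z) z) \<le> ennreal (c * ?F f z + d * ?F g z)"
          using pt by (rule ennreal_leI)
        also have "\<dots> = ennreal c * ennreal (?F f z) + ennreal d * ennreal (?F g z)"
          using pos by (simp add: ennreal_plus ennreal_mult)
        finally show "ennreal (?F (\<lambda>z. f z + g z) z) \<le> \<dots>" .
      qed
      also have "\<dots> = ennreal c * fock_int m r f + ennreal d * fock_int m r g"
        unfolding fock_int_def using mf mg by (simp add: nn_integral_add nn_integral_cmult)
      also have "\<dots> = ennreal (c * a powr r + d * b powr r)"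
        using pos unfolding ff fg by (simp add: ennreal_plus ennreal_mult)
      also have "c * a powr r + d * b powr r = (a + b) powr (r - 1) * (a + b)"
      proof -
        have "x powr (1 - r) * x powr r = x" if "0 < x" for x :: real
          using that by (simp flip: powr_add)
        from this[OF a] this[OF b] show ?thesis
          unfolding c_def d_def mult.assoc by (simp only: distrib_left)
      qed
      also have "\<dots> = (a + b) powr r"
        using a b powr_mult_base[of "a + b" "r - 1"] by (simp add: mult.commute)
      finally have le: "fock_int m r (\<lambda>z. f z + g z) \<le> ennreal ((a + b) powr r)" .
      then have fin: "fock_int m r (\<lambda>z. f z + g z) < top"
        using ennreal_less_top le_less_trans by blast
      have "enn2real (fock_int m r (\<lambda>z. f z + g z)) powr (1 / r) \<le> ((a + b) powr r) powr (1 / r)"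
        using enn2real_mono[OF le] r by (intro powr_mono2) auto
      also have "\<dots> = a + b" using a b r by (simp add: powr_powr)
      finally show ?thesis using False hfg fin
        by (simp add: fock_space_def fock_norm_def a_def b_def flip: r_def)
    qed
  qed
  then show "(\<lambda>z. f z + g z) \<in> fock_space m p"
    and "fock_norm m p (\<lambda>z. f z + g z) \<le> fock_norm m p f + fock_norm m p g" by auto
qed

lemma fock_space_diff:
  assumes p: "1 \<le> p" and f: "f \<in> fock_space m p" and g: "g \<in> fock_space m p"
  shows "(\<lambda>z. f z - g z) \<in> fock_space m p"
proof -
  have "(\<lambda>z. - g z) \<in> fock_space m p"
    using g by (simp add: fock_space_def fock_int_def fock_sup_def holomorphic_on_minus split: if_splits)
  from fock_norm_add(1)[OF p f this] show ?thesis by simp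
qed

lemma Metric_space_fock:
  assumes "1 \<le> p"
  shows "Metric_space (fock_space m p) (fock_dist m p)"
proof
  fix f g h
  show "0 \<le> fock_dist m p f g" by (simp add: fock_dist_def fock_norm_nonneg)
  show "fock_dist m p f g = fock_dist m p g f" by (rule fock_dist_commute)
  assume f: "f \<in> fock_space m p" and g: "g \<in> fock_space m p"
  show "fock_dist m p f g = 0 \<longleftrightarrow> f = g"
    using fock_norm_eq_0D[OF assms fock_space_diff[OF assms f g]]
    by (auto simp: fock_dist_def fock_norm_zero)
  assume h: "h \<in> fock_space m p"
  show "fock_dist m p f h \<le> fock_dist m p f g + fock_dist m p g h"
    using fock_norm_add(2)[OF assms fock_space_diff[OF assms f g] fock_space_diff[OF assms g h]]
    by (simp add: fock_dist_def)
qed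

end

(* If D has closed range, the Baire argument of the open mapping theorem gives norm f <= K norm f' for
   all f in F_(m,p) with f 0 = 0, so together with boundedness the norms of f and f' are comparable.
   If p differs from q, take the normalised monomials u_n: they tend to 0 locally uniformly, so by the
   Brezis-Lieb lemma sums of N terms of a sparse subsequence of (u_n) have p-norm comparable to
   N^(1/p), while those of (u_n') have q-norm comparable to N^(1/q), a contradiction. If p = q,
   iterating the comparison on z^n gives norm (z^n) = n! up to exponential factors, while
   directly norm (z^n) = n^(n/m) up to exponential factors, hence m = 1. Conversely, for m = 1 the
   primitive f z = integral over [0,1] of z g(tz) dt is estimated by Jensen's inequality up to
   constants, Tonelli and scaling. *)
theory Submission
  imports Defs
begin

section \<open>Rotations and the mean value inequality\<close>

text \<open>The two-sided estimate is tested only on monomials and their finite sums;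
  \<open>f 0 = 0\<close> enters because D annihilates constants. Of two different exponents the
  smaller is finite, while the larger may be infinite. The lower bound for sparse sums is therefore
  always placed on the smaller exponent, and one contradiction serves both orders with u_n and u_n'
  exchanged. Brezis-Lieb has no analogue for the sup norm: there monomials decay against the weight,
  so a late term is small wherever the earlier sum is large, and sparse sums stay bounded.

  Monomial norms are never computed. For s > 0 the power n^(sn) outgrows every B^n, so it suffices
  to dominate z^n by a multiple of exp(|z|^m / 2) from above and to evaluate it at radius n^(1/m)
  from below. Evaluation is bounded by the mean value inequality on unit discs, obtained by
  averaging circle means over rotations.

  In the converse, moving the kernel onto g by Tonelli leaves the mass 1 + 1/|w|. Its singularity at
  the origin is why, for finite exponents, g 0 is split off and treated by the primitive g 0
  z.\<close>

lemma lborel_complex_eq_distr: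
  "distr (lborel \<Otimes>\<^sub>M lborel) borel (\<lambda>(x, y). Complex x y) = (lborel :: complex measure)"
proof (rule sym, rule lborel_eqI)
  have cont: "continuous_on UNIV (\<lambda>p. Complex (fst p) (snd p))"
    by (subst Complex_eq) (intro continuous_intros)
  have [measurable]: "(\<lambda>(x, y). Complex x y) \<in> borel_measurable (borel \<Otimes>\<^sub>M borel)"
    using borel_measurable_continuous_onI[OF cont] by (simp add: borel_prod case_prod_unfold)
  fix l u :: complex
  assume le: "\<And>b. b \<in> Basis \<Longrightarrow> l \<bullet> b \<le> u \<bullet> b"
  have le': "Re l \<le> Re u" "Im l \<le> Im u"
    using le[of 1] le[of \<i>] by (auto simp: Basis_complex_def)
  have vimage: "(\<lambda>(x, y). Complex x y) -` box l u = {Re l<..<Re u} \<times> {Im l<..<Im u}"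
    by (auto simp: in_box_complex_iff)
  show "emeasure (distr (lborel \<Otimes>\<^sub>M lborel) borel (\<lambda>(x, y). Complex x y)) (box l u)
        = (\<Prod>b\<in>Basis. (u - l) \<bullet> b)"
    using le' by (subst emeasure_distr)
      (auto simp: vimage space_pair_measure lborel.emeasure_pair_measure_Times Basis_complex_def
        ennreal_mult)
qed simp

lemma borel_measurable_Complex [measurable]:
  assumes [measurable]: "f \<in> borel_measurable M" "g \<in> borel_measurable M"
  shows "(\<lambda>x. Complex (f x) (g x)) \<in> borel_measurable M"
  unfolding Complex_eq by measurable

lemma nn_integral_complex:
  assumes [measurable]: "f \<in> borel_measurable borel"
  shows "(\<integral>\<^sup>+ z. f z \<partial>lborel) = (\<integral>\<^sup>+ x. \<integral>\<^sup>+ y. f (Complex x y) \<partial>lborel \<partial>lborel)"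
    and "(\<integral>\<^sup>+ z. f z \<partial>lborel) = (\<integral>\<^sup>+ y. \<integral>\<^sup>+ x. f (Complex x y) \<partial>lborel \<partial>lborel)"
proof -
  have "(\<integral>\<^sup>+ z. f z \<partial>lborel) = (\<integral>\<^sup>+ p. f (Complex (fst p) (snd p)) \<partial>(lborel \<Otimes>\<^sub>M lborel))"
    by (subst lborel_complex_eq_distr[symmetric], subst nn_integral_distr)
      (simp_all add: case_prod_unfold)
  also have eq: "\<dots> = (\<integral>\<^sup>+ x. \<integral>\<^sup>+ y. f (Complex x y) \<partial>lborel \<partial>lborel)"
    by (subst lborel.nn_integral_fst[symmetric]) simp_all
  finally show "(\<integral>\<^sup>+ z. f z \<partial>lborel) = (\<integral>\<^sup>+ x. \<integral>\<^sup>+ y. f (Complex x y) \<partial>lborel \<partial>lborel)" .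
  also have "\<dots> = (\<integral>\<^sup>+ y. \<integral>\<^sup>+ x. f (Complex x y) \<partial>lborel \<partial>lborel)"
    by (rule lborel_pair.Fubini'[symmetric]) simp
  finally show "(\<integral>\<^sup>+ z. f z \<partial>lborel) = (\<integral>\<^sup>+ y. \<integral>\<^sup>+ x. f (Complex x y) \<partial>lborel \<partial>lborel)" .
qed

text \<open>A shear translates one coordinate by an amount depending only on the other. With the
  translated coordinate integrated innermost, translation invariance on the line suffices.\<close>

lemma nn_integral_lborel_shear:
  fixes k :: real
  assumes [measurable]: "f \<in> borel_measurable borel"
  shows "(\<integral>\<^sup>+ z. f (Complex (Re z + k * Im z) (Im z)) \<partial>lborel) = (\<integral>\<^sup>+ z. f z \<partial>lborel)"
    and "(\<integral>\<^sup>+ z. f (Complex (Re z) (Im z + k * Re z)) \<partial>lborel) = (\<integral>\<^sup>+ z. f z \<partial>lborel)"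
proof -
  have "(\<integral>\<^sup>+ x. f (Complex (x + k * y) y) \<partial>lborel) = (\<integral>\<^sup>+ x. f (Complex x y) \<partial>lborel)" for y
    using nn_integral_real_affine[of "\<lambda>x. f (Complex x y)" 1 "k * y"] by (simp add: add.commute)
  then show "(\<integral>\<^sup>+ z. f (Complex (Re z + k * Im z) (Im z)) \<partial>lborel) = (\<integral>\<^sup>+ z. f z \<partial>lborel)"
    by (simp add: nn_integral_complex(2))
  have "(\<integral>\<^sup>+ y. f (Complex x (y + k * x)) \<partial>lborel) = (\<integral>\<^sup>+ y. f (Complex x y) \<partial>lborel)" for x
    using nn_integral_real_affine[of "\<lambda>y. f (Complex x y)" 1 "k * x"] by (simp add: add.commute)
  then show "(\<integral>\<^sup>+ z. f (Complex (Re z) (Im z + k * Re z)) \<partial>lborel) = (\<integral>\<^sup>+ z. f z \<partial>lborel)"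
    by (simp add: nn_integral_complex(1))
qed

text \<open>A rotation other than by \<open>\<pi>\<close> is a product of three shears.\<close>
lemma nn_integral_lborel_rotate:
  fixes c :: complex
  assumes [measurable]: "f \<in> borel_measurable borel" and c: "cmod c = 1" "c \<noteq> -1"
  shows "(\<integral>\<^sup>+ z. f (c * z) \<partial>lborel) = (\<integral>\<^sup>+ z. f z \<partial>lborel)"
proof -
  define a b where "a = Re c" and "b = Im c"
  have ab: "a\<^sup>2 + b\<^sup>2 = 1" using c(1) by (simp add: a_def b_def cmod_def)
  have "a \<noteq> -1"
  proof
    assume "a = -1"
    with ab have "b = 0" by simp
    with \<open>a = -1\<close> c(2) show False by (simp add: a_def b_def complex_eq_iff)
  qed
  then have a: "1 + a \<noteq> 0" by simp
  \<comment> \<open>With \<open>a\<close> and \<open>b\<close> the cosine and sine of the rotation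
    angle, this is the tangent of half the angle. The outer two shears have coefficient
    \<open>- t\<close>, the middle one \<open>b\<close>.\<close>
  define t where "t = b / (1 + a)"
  have t1: "t * b = 1 - a"
  proof -
    have "b * b = (1 - a) * (1 + a)" using ab by (simp add: algebra_simps power2_eq_square)
    then show ?thesis using a by (simp add: t_def)
  qed
  have "t + t * a = t * (1 + a)" by (simp add: distrib_left)
  then have t2: "t + t * a = b" using a by (simp add: t_def)
  let ?S = "\<lambda>z. Complex (Re z + - t * Im z) (Im z)"
  let ?T = "\<lambda>z. Complex (Re z) (Im z + b * Re z)"
  have eq: "?S (?T (?S z)) = c * z" for z
  proof (rule complex_eqI)
    have "Re (?S (?T (?S z))) = (1 - t * b) * Re z - (t + t * (1 - t * b)) * Im z"
      by (simp add: algebra_simps)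
    then show "Re (?S (?T (?S z))) = Re (c * z)" by (simp add: t1 t2) (simp add: a_def b_def)
    have "Im (?S (?T (?S z))) = b * Re z + (1 - t * b) * Im z" by (simp add: algebra_simps)
    then show "Im (?S (?T (?S z))) = Im (c * z)" by (simp only: t1) (simp add: a_def b_def)
  qed
  have "(\<integral>\<^sup>+ z. f z \<partial>lborel) = (\<integral>\<^sup>+ z. f (?S z) \<partial>lborel)"
    by (rule nn_integral_lborel_shear(1)[symmetric]) simp
  also have "\<dots> = (\<integral>\<^sup>+ z. f (?S (?T z)) \<partial>lborel)"
    by (rule nn_integral_lborel_shear(2)[symmetric, of "\<lambda>z. f (?S z)"]) measurable
  also have "\<dots> = (\<integral>\<^sup>+ z. f (?S (?T (?S z))) \<partial>lborel)"
    by (rule nn_integral_lborel_shear(1)[symmetric, of "\<lambda>z. f (?S (?T z))"]) measurable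
  finally show ?thesis by (simp only: eq)
qed

text \<open>Cauchy's formula on the unit circle for \<open>F z = f (a + z * w)\<close>. The
  substitution keeps the range of the angle independent of \<open>w\<close>, so that
  \<open>w\<close> can later be integrated at a fixed angle.\<close>

lemma entire_circle_mean_le:
  assumes f: "f holomorphic_on UNIV"
  shows "ennreal (2 * pi * cmod (f a)) \<le> (\<integral>\<^sup>+ t. ennreal (cmod (f (a + cis t * w))) * indicator {0..2*pi} t \<partial>lborel)"
proof -
  define F where "F z = f (a + z * w)" for z
  have F: "F holomorphic_on UNIV"
    unfolding F_def by (intro holomorphic_on_compose_gen[OF _ f, unfolded o_def] holomorphic_intros) auto
  have "((\<lambda>u. F u / (u - 0)) has_contour_integral (2 * of_real pi * \<i> * F 0)) (circlepath 0 1)"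
    by (rule Cauchy_integral_circlepath_simple) (auto intro: holomorphic_on_subset[OF F])
  \<comment> \<open>Along the circle the derivative \<open>\<i> * cis t\<close> cancels the
    denominator except for the factor \<open>\<i>\<close>, which the multiplication by
    \<open>-\<i>\<close> below removes.\<close>
  then have "((\<lambda>t. F (cis t) * \<i>) has_integral (2 * of_real pi * \<i> * F 0)) {0..2*pi}"
    unfolding circlepath_def by (subst (asm) has_contour_integral_part_circlepath_iff) auto
  from has_integral_mult_left[OF this, of "-\<i>"]
  have I: "((\<lambda>t. F (cis t)) has_integral (2 * of_real pi * F 0)) {0..2*pi}"
  proof (rule back_subst[where P = "\<lambda>v. (_ has_integral v) _", OF has_integral_eq[rotated]])
    show "2 * of_real pi * \<i> * F 0 * - \<i> = 2 * of_real pi * F 0" by (simp add: complex_eq_iff)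
  qed (simp add: mult.assoc)
  have cF: "continuous_on {0..2*pi} (\<lambda>t. F (cis t))"
    by (intro continuous_on_compose2[OF holomorphic_on_imp_continuous_on[OF F]] continuous_intros) auto
  then have "continuous_on {0..2*pi} (\<lambda>t. cmod (F (cis t)))" by (intro continuous_intros)
  then have int: "(\<lambda>t. cmod (F (cis t))) integrable_on {0..2*pi}" by (rule integrable_continuous_real)
  have "cmod (integral {0..2*pi} (\<lambda>t. F (cis t))) \<le> integral {0..2*pi} (\<lambda>t. cmod (F (cis t)))"
    using I int by (intro integral_norm_bound_integral) auto
  then have "2 * pi * cmod (F 0) \<le> integral {0..2*pi} (\<lambda>t. cmod (F (cis t)))"
    using integral_unique[OF I] by (simp add: norm_mult)
  then show ?thesis
    using nn_integral_has_integral_lebesgue'[OF _ integrable_integral[OF int]]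
    by (simp add: F_def ennreal_leI)
qed

text \<open>The circle inequality is integrated over \<open>w\<close> in the unit disc and the
  integrals are exchanged. At a fixed angle the integral over \<open>w\<close> is rotation
  invariant, so the angle contributes the factor \<open>2 * pi\<close>, which cancels; the remaining
  \<open>pi\<close> is the area of the disc.\<close>

lemma entire_disc_mean_le:
  assumes f: "f holomorphic_on UNIV"
  shows "ennreal (pi * cmod (f a)) \<le> (\<integral>\<^sup>+ w. ennreal (cmod (f (a + w))) * indicator (ball 0 1) w \<partial>lborel)"
    (is "_ \<le> ?I")
proof -
  have [measurable]: "f \<in> borel_measurable borel"
    using f by (intro borel_measurable_continuous_onI holomorphic_on_imp_continuous_on)
  have [measurable]: "Measurable.pred borel (\<lambda>w::complex. w \<in> ball 0 1)" by simp
  have [measurable]: "cis \<in> borel_measurable borel"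
    by (intro borel_measurable_continuous_onI continuous_intros)
  have rot: "(\<integral>\<^sup>+ w. ennreal (cmod (f (a + cis t * w))) * indicator (ball 0 1) w \<partial>lborel) = ?I"
    if "t \<noteq> pi" "t \<in> {0..2*pi}" for t
  proof -
    have "cis t \<noteq> -1"
    proof
      assume *: "cis t = -1"
      then have c: "cos t = -1" by (simp add: complex_eq_iff)
      show False
      proof (cases "t \<le> pi")
        case True
        then have "t = pi" using that c cos_inj_pi[of t pi] by simp
        then show False using that by simp
      next
        case False
        then have "2 * pi - t = pi" using that c cos_inj_pi[of "2*pi - t" pi] by (simp add: cos_diff)
        then show False using that by simp
      qed
    qed
    then show ?thesis
      using nn_integral_lborel_rotate[of "\<lambda>w. ennreal (cmod (f (a + w))) * indicator (ball 0 1) w" "cis t"]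
      by (simp add: indicator_def norm_mult)
  qed
  have "ennreal (2 * pi) * ennreal (pi * cmod (f a))
      = ennreal (2 * pi * cmod (f a)) * emeasure lborel (ball (0::complex) 1)"
    by (simp add: emeasure_ball unit_ball_vol_2 ennreal_mult'[symmetric] mult_ac)
  also have "\<dots> = (\<integral>\<^sup>+ w. ennreal (2 * pi * cmod (f a)) * indicator (ball (0::complex) 1) w \<partial>lborel)"
    by (simp add: nn_integral_cmult_indicator)
  also have "\<dots> \<le> (\<integral>\<^sup>+ w. (\<integral>\<^sup>+ t. ennreal (cmod (f (a + cis t * w))) * indicator {0..2*pi} t \<partial>lborel)
      * indicator (ball (0::complex) 1) w \<partial>lborel)"
    by (intro nn_integral_mono mult_right_mono entire_circle_mean_le[OF f]) auto
  also have "\<dots> = (\<integral>\<^sup>+ w. \<integral>\<^sup>+ t. ennreal (cmod (f (a + cis t * w))) * indicator {0..2*pi} t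
      * indicator (ball (0::complex) 1) w \<partial>lborel \<partial>lborel)"
    by (subst nn_integral_multc[symmetric]) auto
  also have "\<dots> = (\<integral>\<^sup>+ t. \<integral>\<^sup>+ w. ennreal (cmod (f (a + cis t * w))) * indicator {0..2*pi} t
      * indicator (ball (0::complex) 1) w \<partial>lborel \<partial>lborel)"
    by (rule lborel_pair.Fubini') measurable
  also have "\<dots> = (\<integral>\<^sup>+ t. (\<integral>\<^sup>+ w. ennreal (cmod (f (a + cis t * w)))
      * indicator (ball (0::complex) 1) w \<partial>lborel) * indicator {0..2*pi} t \<partial>lborel)"
    by (subst nn_integral_multc[symmetric]) (auto simp: mult_ac)
  also have "\<dots> = (\<integral>\<^sup>+ t. ?I * indicator {0..2*pi} t \<partial>lborel)"
  \<comment> \<open>The angle \<open>pi\<close>, where \<open>cis t = -1\<close> is outside the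
    reach of the rotation lemma, is a null set.\<close>
  proof (rule nn_integral_cong_AE)
    show "AE t in lborel. (\<integral>\<^sup>+ w. ennreal (cmod (f (a + cis t * w)))
      * indicator (ball (0::complex) 1) w \<partial>lborel) * indicator {0..2*pi} t = ?I * indicator {0..2*pi} t"
      using AE_lborel_singleton[of pi] by eventually_elim (auto simp: rot split: split_indicator)
  qed
  also have "\<dots> = ennreal (2 * pi) * ?I"
    by (subst nn_integral_cmult_indicator) (simp_all add: mult.commute)
  finally show ?thesis
    by (simp add: ennreal_mult_le_mult_iff)
qed

section \<open>Norms, pointwise bounds and completeness\<close>

text \<open>For every exponent the norm is the Lebesgue norm of this one function, so pointwise
  inequalities between weighted moduli integrate directly to inequalities between norms.\<close>

definition fock_weighted :: "real \<Rightarrow> (complex \<Rightarrow> complex) \<Rightarrow> complex \<Rightarrow> real" where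
  "fock_weighted m f z = cmod (f z) * exp (- (cmod z powr m))"

lemma fock_weighted_nonneg [simp]: "0 \<le> fock_weighted m f z"
  by (simp add: fock_weighted_def)

lemma borel_measurable_fock_weighted [measurable]:
  assumes [measurable]: "f \<in> borel_measurable borel"
  shows "fock_weighted m f \<in> borel_measurable borel"
  unfolding fock_weighted_def[abs_def] by measurable

lemma borel_measurable_entire: "f holomorphic_on UNIV \<Longrightarrow> f \<in> borel_measurable borel"
  by (intro borel_measurable_continuous_onI holomorphic_on_imp_continuous_on)

lemma fock_int_eq: "fock_int m r f = (\<integral>\<^sup>+ z. ennreal (fock_weighted m f z powr r) \<partial>lborel)"
  unfolding fock_int_def fock_weighted_def by (simp add: powr_mult exp_powr_real mult.commute[of _ r])

lemma exponent_cases: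
  assumes "1 \<le> (p :: ennreal)"
  obtains "p = \<infinity>" | r where "1 \<le> r" "p = ennreal r"
  using assms by (cases p) auto

lemma fock_space_entire: "f \<in> fock_space m p \<Longrightarrow> f holomorphic_on UNIV"
  by (simp add: fock_space_def)

lemma fock_int_eq_norm_powr:
  assumes "1 \<le> r" "f \<in> fock_space m (ennreal r)"
  shows "fock_int m r f = ennreal (fock_norm m (ennreal r) f powr r)"
  using assms by (auto simp: fock_space_def fock_norm_def powr_powr)

lemma fock_spaceI_int:
  assumes "1 \<le> r" "f holomorphic_on UNIV" "0 \<le> B" "fock_int m r f \<le> ennreal (B powr r)"
  shows "f \<in> fock_space m (ennreal r)" "fock_norm m (ennreal r) f \<le> B"
proof -
  have fin: "fock_int m r f < \<infinity>" using assms(4) ennreal_less_top le_less_trans by fastforce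
  then show "f \<in> fock_space m (ennreal r)" using assms by (simp add: fock_space_def)
  have "enn2real (fock_int m r f) powr (1 / r) \<le> (B powr r) powr (1 / r)"
    using enn2real_mono[OF assms(4)] assms by (intro powr_mono2) auto
  then show "fock_norm m (ennreal r) f \<le> B"
    using assms by (simp add: fock_norm_def powr_powr)
qed

lemma fock_weighted_le_norm:
  assumes "f \<in> fock_space m \<infinity>"
  shows "fock_weighted m f z \<le> fock_norm m \<infinity> f"
proof -
  have "ennreal (fock_weighted m f z) \<le> fock_sup m f"
    unfolding fock_sup_def fock_weighted_def by (rule SUP_upper) simp
  from enn2real_mono[OF this] show ?thesis using assms by (simp add: fock_space_def fock_norm_def)
qed

lemma fock_spaceI_sup:
  assumes "f holomorphic_on UNIV" "\<And>z. fock_weighted m f z \<le> B"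
  shows "f \<in> fock_space m \<infinity>" "fock_norm m \<infinity> f \<le> B"
proof -
  have B: "0 \<le> B" using assms(2)[of 0] order_trans[OF fock_weighted_nonneg] by blast
  have le: "fock_sup m f \<le> ennreal B"
    unfolding fock_sup_def using assms(2) by (intro SUP_least ennreal_leI) (simp add: fock_weighted_def)
  then show "f \<in> fock_space m \<infinity>"
    using assms(1) ennreal_less_top le_less_trans by (fastforce simp: fock_space_def)
  show "fock_norm m \<infinity> f \<le> B"
    using enn2real_mono[OF le] B by (simp add: fock_norm_def)
qed

lemma fock_norm_cmult:
  assumes p: "1 \<le> p" and f: "f \<in> fock_space m p"
  shows "(\<lambda>z. c * f z) \<in> fock_space m p"
    and "fock_norm m p (\<lambda>z. c * f z) = cmod c * fock_norm m p f"
proof -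
  have W: "fock_weighted m (\<lambda>z. c * f z) z = cmod c * fock_weighted m f z" for c f z
    by (simp add: fock_weighted_def norm_mult mult.assoc)
  have le: "(\<lambda>z. c * f z) \<in> fock_space m p \<and> fock_norm m p (\<lambda>z. c * f z) \<le> cmod c * fock_norm m p f"
    if f: "f \<in> fock_space m p" for c f
  proof -
    have hol: "(\<lambda>z. c * f z) holomorphic_on UNIV"
      using fock_space_entire[OF f] by (intro holomorphic_intros)
    from p show ?thesis
    proof (cases rule: exponent_cases)
      case 1
      then show ?thesis
        using fock_spaceI_sup[OF hol, of m "cmod c * fock_norm m p f"] fock_weighted_le_norm[of f m] f
        by (simp add: W mult_left_mono)
    next
      case (2 r)
      have [measurable]: "f \<in> borel_measurable borel"
        by (rule borel_measurable_entire[OF fock_space_entire[OF f]])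
      have "fock_int m r (\<lambda>z. c * f z) = ennreal (cmod c powr r) * fock_int m r f"
        by (simp add: fock_int_eq W powr_mult ennreal_mult' nn_integral_cmult)
      also have "\<dots> = ennreal ((cmod c * fock_norm m p f) powr r)"
        using 2 f by (simp add: fock_int_eq_norm_powr ennreal_mult' powr_mult fock_norm_nonneg)
      finally show ?thesis
        using 2 fock_spaceI_int[OF 2(1) hol, of "cmod c * fock_norm m p f" m] by (simp add: fock_norm_nonneg)
    qed
  qed
  show mem: "(\<lambda>z. c * f z) \<in> fock_space m p" using le[OF f] by simp
  show "fock_norm m p (\<lambda>z. c * f z) = cmod c * fock_norm m p f"
  proof (cases "c = 0")
    case True
    then show ?thesis by (simp add: fock_norm_zero)
  next
    case False
    \<comment> \<open>The reverse inequality is the bound already proved, applied to the multiple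
      with the factor \<open>inverse c\<close>.\<close>
    have "fock_norm m p f \<le> inverse (cmod c) * fock_norm m p (\<lambda>z. c * f z)"
      using le[OF mem, of "inverse c"] False by (simp add: norm_inverse flip: mult.assoc)
    then have "cmod c * fock_norm m p f \<le> fock_norm m p (\<lambda>z. c * f z)"
      using False by (simp add: field_simps)
    then show ?thesis using le[OF f, of c] by simp
  qed
qed

lemma fock_norm_diff:
  assumes "1 \<le> p" "f \<in> fock_space m p" "g \<in> fock_space m p"
  shows "fock_norm m p (\<lambda>z. f z - g z) \<le> fock_norm m p f + fock_norm m p g"
  using fock_norm_add(2)[OF assms(1,2) fock_norm_cmult(1)[OF assms(1,3), of "-1"]]
    fock_norm_cmult(2)[OF assms(1,3), of "-1"] by simp

text \<open>Fatou's lemma for finite exponents, and a pointwise limit of bounds for the sup norm. It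
  puts limits back into the space, both for completeness and for the closedness of the sets in the
  Baire argument.\<close>

lemma fock_norm_fatou:
  assumes p: "1 \<le> p" and F: "\<And>n. F n \<in> fock_space m p" and B: "\<And>n. fock_norm m p (F n) \<le> B"
    and lim: "\<And>z. (\<lambda>n. F n z) \<longlonglongrightarrow> f z" and hol: "f holomorphic_on UNIV"
  shows "f \<in> fock_space m p" "fock_norm m p f \<le> B"
proof -
  have W: "(\<lambda>n. fock_weighted m (F n) z) \<longlonglongrightarrow> fock_weighted m f z" for z
    unfolding fock_weighted_def by (intro tendsto_intros lim)
  have B0: "0 \<le> B" by (rule order_trans[OF fock_norm_nonneg B])
  have "f \<in> fock_space m p \<and> fock_norm m p f \<le> B"
    using p
  proof (cases rule: exponent_cases)
    case 1
    have le: "fock_weighted m f z \<le> B" for z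
    proof (rule LIMSEQ_le_const2[OF W])
      show "\<exists>N. \<forall>n\<ge>N. fock_weighted m (F n) z \<le> B"
        using order_trans[OF fock_weighted_le_norm] F B 1 by metis
    qed
    then show ?thesis using fock_spaceI_sup[OF hol, OF le] 1 by simp
  next
    case (2 r)
    have [measurable]: "F n \<in> borel_measurable borel" for n
      by (rule borel_measurable_entire[OF fock_space_entire[OF F]])
    have Wr: "(\<lambda>n. ennreal (fock_weighted m (F n) z powr r)) \<longlonglongrightarrow> ennreal (fock_weighted m f z powr r)" for z
      using 2 by (intro tendsto_ennrealI tendsto_powr' W tendsto_const) auto
    have "fock_int m r f = (\<integral>\<^sup>+ z. liminf (\<lambda>n. ennreal (fock_weighted m (F n) z powr r)) \<partial>lborel)"
      unfolding fock_int_eq by (intro nn_integral_cong) (use lim_imp_Liminf[OF _ Wr] in auto)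
    also have "\<dots> \<le> liminf (\<lambda>n. \<integral>\<^sup>+ z. ennreal (fock_weighted m (F n) z powr r) \<partial>lborel)"
      by (intro nn_integral_liminf) simp
    also have "\<dots> \<le> liminf (\<lambda>n. ennreal (B powr r))"
    proof (intro Liminf_mono always_eventually allI)
      fix n
      have "fock_norm m p (F n) powr r \<le> B powr r"
        using 2 B by (intro powr_mono2) (auto simp: fock_norm_nonneg)
      then show "(\<integral>\<^sup>+ z. ennreal (fock_weighted m (F n) z powr r) \<partial>lborel) \<le> ennreal (B powr r)"
        using fock_int_eq_norm_powr[of r "F n" m] F[of n] 2 by (simp add: fock_int_eq ennreal_leI)
    qed
    also have "\<dots> = ennreal (B powr r)" by (simp add: Liminf_const)
    finally show ?thesis using fock_spaceI_int[OF 2(1) hol B0] 2 by simp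
  qed
  then show "f \<in> fock_space m p" "fock_norm m p f \<le> B" by auto
qed

section \<open>Integrability of the weight and domination by half of it\<close>

text \<open>The inequality \<open>y \<le> exp y\<close> at \<open>y = c * x / s\<close>, raised to
  the power \<open>s\<close>. The constant exceeds the optimal one by the factor
  \<open>exp s\<close>, which is harmless since only exponential precision is used later.\<close>

lemma powr_le_const_exp:
  fixes x s c :: real
  assumes "0 \<le> x" "0 < s" "0 < c"
  shows "x powr s \<le> (s / c) powr s * exp (c * x)"
proof -
  have "c * x / s \<le> exp (c * x / s)" using exp_ge_add_one_self[of "c * x / s"] by linarith
  then have "(c * x / s) powr s \<le> exp (c * x / s) powr s" using assms by (intro powr_mono2) auto
  also have "\<dots> = exp (c * x)" using assms by (simp add: exp_powr_real)
  finally have le: "(c * x / s) powr s \<le> exp (c * x)" .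
  have "x powr s = ((s / c) * (c * x / s)) powr s" using assms by simp
  also have "\<dots> = (s / c) powr s * (c * x / s) powr s" using assms by (intro powr_mult)
  also have "\<dots> \<le> (s / c) powr s * exp (c * x)" using le by (intro mult_left_mono) auto
  finally show ?thesis .
qed

lemma nn_integral_inverse_1_plus_square: "(\<integral>\<^sup>+ x. ennreal (1 / (1 + x\<^sup>2)) \<partial>lborel) < \<infinity>"
proof -
  let ?f = "\<lambda>x::real. ennreal (1 / (1 + x\<^sup>2))"
  have half: "(\<integral>\<^sup>+ x. ?f x * indicator {0..} x \<partial>lborel) = ennreal (pi / 2 - arctan 0)"
  proof (rule nn_integral_FTC_atLeast)
    show "(arctan has_real_derivative 1 / (1 + x\<^sup>2)) (at x)" for x
      using DERIV_arctan[of x] by (simp add: inverse_eq_divide)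
  qed (auto intro: tendsto_arctan_at_top)
  have "(\<integral>\<^sup>+ x. ?f x \<partial>lborel) \<le> (\<integral>\<^sup>+ x. ?f x * indicator {0..} x + ?f (-x) * indicator {0..} (-x) \<partial>lborel)"
    by (intro nn_integral_mono) (auto simp: indicator_def)
  also have "\<dots> = (\<integral>\<^sup>+ x. ?f x * indicator {0..} x \<partial>lborel) + (\<integral>\<^sup>+ x. ?f (-x) * indicator {0..} (-x) \<partial>lborel)"
    by (rule nn_integral_add) auto
  also have "(\<integral>\<^sup>+ x. ?f (-x) * indicator {0..} (-x) \<partial>lborel) = (\<integral>\<^sup>+ x. ?f x * indicator {0..} x \<partial>lborel)"
    using nn_integral_real_affine[of "\<lambda>x. ?f x * indicator {0..} x" "-1" 0] by simp
  finally show ?thesis unfolding half using le_less_trans[OF _ ennreal_less_top]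
    by (simp add: ennreal_plus[symmetric] del: ennreal_plus)
qed

text \<open>The radial integrand is majorised by a product of functions of \<open>Re z\<close> and
  \<open>Im z\<close>, which splits the area integral into two integrals over the line.\<close>

lemma nn_integral_exp_neg_powr_finite:
  fixes c m :: real
  assumes c: "0 < c" and m: "0 < m"
  shows "(\<integral>\<^sup>+ (z::complex). ennreal (exp (- (c * cmod z powr m))) \<partial>lborel) < \<infinity>"
proof -
  \<comment> \<open>From (1 + x^2)(1 + y^2) \<le> 2 + 2 |z|^4, where |z|^4 = (|z|^m)^(4/m) is
    bounded by \<open>powr_le_const_exp\<close> with exponent \<open>4 / m\<close>.\<close>
  define K where "K = 2 + 2 * (4 / m / c) powr (4 / m)"
  have K: "0 \<le> K" by (simp add: K_def)
  have bound: "exp (- (c * cmod z powr m)) \<le> K * (1 / (1 + (Re z)\<^sup>2) * (1 / (1 + (Im z)\<^sup>2)))" for z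
  proof -
    define \<rho> where "\<rho> = cmod z"
    have \<rho>: "0 \<le> \<rho>" "\<rho>\<^sup>2 = (Re z)\<^sup>2 + (Im z)\<^sup>2" by (simp_all add: \<rho>_def cmod_power2)
    have "\<rho> ^ 4 = (\<rho> powr m) powr (4 / m)"
    proof (cases "\<rho> = 0")
      case False
      then show ?thesis using \<rho> m by (simp add: powr_powr powr_numeral)
    qed (use m in simp)
    also have "\<dots> \<le> (4 / m / c) powr (4 / m) * exp (c * \<rho> powr m)"
      using c m by (intro powr_le_const_exp) auto
    finally have 4: "\<rho> ^ 4 \<le> (4 / m / c) powr (4 / m) * exp (c * \<rho> powr m)" .
    have "(1 + (Re z)\<^sup>2) * (1 + (Im z)\<^sup>2) \<le> (1 + \<rho>\<^sup>2) * (1 + \<rho>\<^sup>2)"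
      unfolding \<rho>(2) by (intro mult_mono) auto
    also have "\<dots> \<le> 2 + 2 * \<rho> ^ 4"
      using sum_squares_bound[of 1 "\<rho>\<^sup>2"] by (simp add: power2_eq_square power4_eq_xxxx algebra_simps)
    also have "\<dots> \<le> K * exp (c * \<rho> powr m)"
    proof -
      have "2 \<le> 2 * exp (c * \<rho> powr m)" using c by simp
      moreover have "K * exp (c * \<rho> powr m)
          = 2 * exp (c * \<rho> powr m) + 2 * ((4 / m / c) powr (4 / m) * exp (c * \<rho> powr m))"
        by (simp add: K_def distrib_right)
      ultimately show ?thesis using 4 by linarith
    qed
    finally have "(1 + (Re z)\<^sup>2) * (1 + (Im z)\<^sup>2) * exp (- (c * \<rho> powr m))
        \<le> K * exp (c * \<rho> powr m) * exp (- (c * \<rho> powr m))" by (rule mult_right_mono) simp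
    also have "\<dots> = K" by (simp add: mult.assoc flip: exp_add)
    finally have "exp (- (c * \<rho> powr m)) \<le> K / ((1 + (Re z)\<^sup>2) * (1 + (Im z)\<^sup>2))"
      by (subst pos_le_divide_eq) (auto simp: mult.commute add_pos_nonneg)
    then show ?thesis by (simp add: \<rho>_def)
  qed
  let ?f = "\<lambda>x::real. ennreal (1 / (1 + x\<^sup>2))"
  have "(\<integral>\<^sup>+ (z::complex). ennreal (exp (- (c * cmod z powr m))) \<partial>lborel)
      \<le> (\<integral>\<^sup>+ (z::complex). ennreal K * (?f (Re z) * ?f (Im z)) \<partial>lborel)"
    using bound K by (intro nn_integral_mono) (simp add: ennreal_leI flip: ennreal_mult)
  also have "\<dots> = ennreal K * ((\<integral>\<^sup>+ x. ?f x \<partial>lborel) * (\<integral>\<^sup>+ x. ?f x \<partial>lborel))"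
    by (simp add: nn_integral_complex(1) nn_integral_cmult nn_integral_multc)
  also have "\<dots> < \<infinity>"
    using nn_integral_inverse_1_plus_square by (simp add: ennreal_mult_less_top)
  finally show ?thesis .
qed

text \<open>Half of the weight is spent on the growth of \<open>f\<close>; the other half is still
  bounded and integrable. The constant depends on \<open>m\<close> and \<open>p\<close>
  only.\<close>

lemma fock_dominated:
  assumes p: "1 \<le> p" and m: "0 < m"
  obtains M where "0 < M"
    "\<And>f A. f holomorphic_on UNIV \<Longrightarrow> (\<And>z. cmod (f z) \<le> A * exp (cmod z powr m / 2)) \<Longrightarrow>
       f \<in> fock_space m p \<and> fock_norm m p f \<le> A * M"
proof -
  have W: "fock_weighted m f z \<le> A * exp (- (cmod z powr m / 2))"
    if "\<And>z. cmod (f z) \<le> A * exp (cmod z powr m / 2)" for f A z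
  proof -
    have "fock_weighted m f z \<le> A * exp (cmod z powr m / 2) * exp (- (cmod z powr m))"
      unfolding fock_weighted_def by (intro mult_right_mono that) simp
    also have "\<dots> = A * exp (- (cmod z powr m / 2))" by (simp add: mult.assoc flip: exp_add)
    finally show ?thesis .
  qed
  have A0: "0 \<le> A" if "\<And>z. cmod (f z) \<le> A * exp (cmod z powr m / 2)" for f :: "complex \<Rightarrow> complex" and A
    using order_trans[OF norm_ge_zero that[of 0]] by (simp add: zero_le_mult_iff)
  show thesis
    using p
  proof (cases rule: exponent_cases)
    case 1
    show thesis
    proof (rule that[of 1])
      fix f :: "complex \<Rightarrow> complex" and A
      assume hol: "f holomorphic_on UNIV" and le: "\<And>z. cmod (f z) \<le> A * exp (cmod z powr m / 2)"
      have leA: "fock_weighted m f z \<le> A" for z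
        using W[OF le, of z] mult_left_mono[OF _ A0[OF le], of "exp (- (cmod z powr m / 2))" 1] by simp
      then show "f \<in> fock_space m p \<and> fock_norm m p f \<le> A * 1" using fock_spaceI_sup[OF hol, OF leA] 1 by simp
    qed simp
  next
    case (2 r)
    define I where "I = enn2real (\<integral>\<^sup>+ (z::complex). ennreal (exp (- (r / 2 * cmod z powr m))) \<partial>lborel)"
    have I: "(\<integral>\<^sup>+ (z::complex). ennreal (exp (- (r / 2 * cmod z powr m))) \<partial>lborel) = ennreal I"
      using nn_integral_exp_neg_powr_finite[of "r/2" m] 2 m unfolding I_def by simp
    have "0 \<le> I" by (simp add: I_def)
    show thesis
    \<comment> \<open>\<open>I\<close> would do for the estimate; \<open>I + 1\<close> makes
      positivity of the constant evident.\<close>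
    proof (rule that[of "(I + 1) powr (1 / r)"])
      fix f :: "complex \<Rightarrow> complex" and A
      assume hol: "f holomorphic_on UNIV" and le: "\<And>z. cmod (f z) \<le> A * exp (cmod z powr m / 2)"
      have A: "0 \<le> A" by (rule A0[OF le])
      have "fock_int m r f \<le> (\<integral>\<^sup>+ z. ennreal (A powr r) * ennreal (exp (- (r / 2 * cmod z powr m))) \<partial>lborel)"
        unfolding fock_int_eq
      proof (rule nn_integral_mono)
        fix z
        have "fock_weighted m f z powr r \<le> (A * exp (- (cmod z powr m / 2))) powr r"
          using W[OF le] 2 by (intro powr_mono2) auto
        also have "\<dots> = A powr r * exp (- (r / 2 * cmod z powr m))"
          using A by (simp add: powr_mult exp_powr_real mult.commute)
        finally show "ennreal (fock_weighted m f z powr r)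
            \<le> ennreal (A powr r) * ennreal (exp (- (r / 2 * cmod z powr m)))"
          by (simp add: ennreal_leI flip: ennreal_mult)
      qed
      also have "\<dots> = ennreal (A powr r * I)"
        using I by (simp add: nn_integral_cmult I_def ennreal_mult)
      also have "\<dots> \<le> ennreal ((A * (I + 1) powr (1 / r)) powr r)"
        using A 2 by (intro ennreal_leI) (simp add: powr_mult powr_powr mult_left_mono I_def)
      finally have "fock_int m r f \<le> ennreal ((A * (I + 1) powr (1 / r)) powr r)" .
      from fock_spaceI_int[OF 2(1) hol _ this]
      show "f \<in> fock_space m p \<and> fock_norm m p f \<le> A * (I + 1) powr (1 / r)"
        using A 2 by simp
    qed (use \<open>0 \<le> I\<close> in auto)
  qed
qed

text \<open>A substitute for Jensen's inequality: integrated with \<open>L\<close> of the size of the quantity to be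
  bounded, it bounds that quantity by an \<open>r\<close>-th power mean up to a constant.\<close>
lemma le_add_powr:
  fixes L x r :: real
  assumes "0 < L" "0 \<le> x" "1 \<le> r"
  shows "x \<le> L + L powr (1 - r) * x powr r"
proof (cases "x \<le> L")
  case False
  then have x: "0 < x" using assms by simp
  have "1 \<le> (x / L) powr (r - 1)" using False assms by (intro ge_one_powr_ge_zero) auto
  then have "x * 1 \<le> x * (x / L) powr (r - 1)" using x by (intro mult_left_mono) auto
  also have "\<dots> = L powr (1 - r) * x powr r"
    using x assms(1) by (simp add: powr_divide powr_diff divide_simps)
  finally show ?thesis using assms(1) by simp
next
  case True
  have "0 \<le> L powr (1 - r) * x powr r" by simp
  with True show ?thesis by linarith
qed

section \<open>Bounded point evaluations and completeness\<close>

text \<open>For a finite exponent the mean value inequality on the unit disc about \<open>z\<close>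
  is combined with \<open>le_add_powr\<close>. On that disc the reciprocal of the weight is at most
  exp((|z| + 1)^m). The linear term contributes \<open>L * pi\<close> and the power term
  \<open>L\<close>, together at most \<open>2 * pi * L\<close>; hence the factor 2.\<close>

lemma fock_pointwise_bound:
  assumes p: "1 \<le> p" and m: "0 < m" and f: "f \<in> fock_space m p"
  shows "cmod (f z) \<le> 2 * exp ((cmod z + 1) powr m) * fock_norm m p f"
  using p
proof (cases rule: exponent_cases)
  case 1
  have "cmod (f z) = fock_weighted m f z * exp (cmod z powr m)"
    by (simp add: fock_weighted_def mult.assoc flip: exp_add)
  also have "\<dots> \<le> fock_norm m p f * (2 * exp ((cmod z + 1) powr m))"
  proof (intro mult_mono)
    have "exp (cmod z powr m) \<le> exp ((cmod z + 1) powr m)" using m by (simp add: powr_mono2)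
    then show "exp (cmod z powr m) \<le> 2 * exp ((cmod z + 1) powr m)"
      using exp_gt_zero[of "(cmod z + 1) powr m"] by linarith
    show "fock_weighted m f z \<le> fock_norm m p f" using fock_weighted_le_norm f 1 by simp
  qed (simp_all add: fock_norm_nonneg)
  finally show ?thesis by (simp add: mult_ac)
next
  case (2 r)
  note hol = fock_space_entire[OF f]
  have [measurable]: "f \<in> borel_measurable borel" by (rule borel_measurable_entire[OF hol])
  define N where "N = fock_norm m p f"
  show ?thesis
  proof (cases "N = 0")
    case True
    then show ?thesis using fock_norm_eq_0D[OF p f] by (simp add: N_def)
  next
    case False
    then have N: "0 < N" using fock_norm_nonneg[of m p f] by (simp add: N_def)
    define E where "E = exp ((cmod z + 1) powr m)"
    \<comment> \<open>The size of the bound to be proved. With this choice the power term integrates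
      to exactly \<open>L\<close>.\<close>
    define L where "L = E * N"
    have E: "0 < E" and L: "0 < L" using N by (simp_all add: E_def L_def)
    have pt: "cmod (f (z + w)) \<le> L + L powr (1 - r) * E powr r * fock_weighted m f (z + w) powr r"
      if "w \<in> ball 0 1" for w
    proof -
      define x where "x = cmod (f (z + w))"
      have "x \<le> L + L powr (1 - r) * x powr r"
        using L 2 by (intro le_add_powr) (auto simp: x_def)
      moreover have "x \<le> E * fock_weighted m f (z + w)"
      proof -
        have "cmod (z + w) \<le> cmod z + 1" using norm_triangle_ineq[of z w] that by simp
        then have "exp (cmod (z + w) powr m) \<le> E" using m by (simp add: E_def powr_mono2)
        then have "exp (cmod (z + w) powr m) * fock_weighted m f (z + w) \<le> E * fock_weighted m f (z + w)"
          by (rule mult_right_mono) simp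
        moreover have "exp (cmod (z + w) powr m) * fock_weighted m f (z + w) = x"
          by (simp add: fock_weighted_def x_def mult.left_commute flip: exp_add)
        ultimately show ?thesis by simp
      qed
      then have "x powr r \<le> (E * fock_weighted m f (z + w)) powr r"
        using 2 by (intro powr_mono2) (auto simp: x_def)
      then have "L powr (1 - r) * x powr r \<le> L powr (1 - r) * E powr r * fock_weighted m f (z + w) powr r"
        using E by (simp add: powr_mult mult_left_mono mult.assoc)
      ultimately show ?thesis unfolding x_def by linarith
    qed
    have [measurable]: "Measurable.pred borel (\<lambda>w::complex. w \<in> ball 0 1)" by simp
    define c where "c = L powr (1 - r) * E powr r"
    have c: "0 \<le> c" by (simp add: c_def)
    have "ennreal (pi * cmod (f z)) \<le> (\<integral>\<^sup>+ w. ennreal (cmod (f (z + w))) * indicator (ball 0 1) w \<partial>lborel)"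
      by (rule entire_disc_mean_le[OF hol])
    also have "\<dots> \<le> (\<integral>\<^sup>+ w. ennreal L * indicator (ball 0 1) w
        + ennreal c * ennreal (fock_weighted m f (z + w) powr r) \<partial>lborel)"
    proof (rule nn_integral_mono)
      fix w
      show "ennreal (cmod (f (z + w))) * indicator (ball 0 1) w \<le> ennreal L * indicator (ball 0 1) w
        + ennreal c * ennreal (fock_weighted m f (z + w) powr r)"
      proof (cases "w \<in> ball 0 1")
        case True
        have "ennreal (cmod (f (z + w))) \<le> ennreal (L + c * fock_weighted m f (z + w) powr r)"
          using pt[OF True] by (intro ennreal_leI) (simp add: c_def)
        also have "\<dots> = ennreal L + ennreal c * ennreal (fock_weighted m f (z + w) powr r)"
          using L c by (simp add: ennreal_plus ennreal_mult)
        finally show ?thesis using True by simp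
      qed simp
    qed
    also have "\<dots> = ennreal L * ennreal pi + ennreal c * (\<integral>\<^sup>+ w. ennreal (fock_weighted m f (z + w) powr r) \<partial>lborel)"
      by (subst nn_integral_add)
        (auto simp: nn_integral_cmult nn_integral_cmult_indicator emeasure_ball unit_ball_vol_2)
    also have "(\<integral>\<^sup>+ w. ennreal (fock_weighted m f (z + w) powr r) \<partial>lborel) = fock_int m r f"
      unfolding fock_int_eq by (subst (2) lborel_distr_plus[of z, symmetric]) (simp add: nn_integral_distr)
    also have "\<dots> = ennreal (N powr r)" using fock_int_eq_norm_powr[OF 2(1)] f 2 by (simp add: N_def)
    also have "ennreal L * ennreal pi + ennreal c * ennreal (N powr r) = ennreal (L * pi + c * N powr r)"
      using L c by (simp add: ennreal_plus ennreal_mult)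
    also have "c * N powr r = L"
    proof -
      have "c * N powr r = L powr (1 - r) * L powr r"
        using E N by (simp add: c_def L_def powr_mult mult.assoc)
      also have "\<dots> = L" using L by (simp flip: powr_add)
      finally show ?thesis .
    qed
    finally have "pi * cmod (f z) \<le> L * pi + L" using L
      by (subst (asm) ennreal_le_iff) auto
    also have "\<dots> \<le> pi * (2 * L)" using L pi_gt3 by (simp add: algebra_simps)
    finally show ?thesis by (simp add: L_def E_def N_def mult_ac)
  qed
qed

text \<open>Point evaluations are bounded uniformly on discs, so a Cauchy sequence converges locally
  uniformly and its limit is entire. Fatou applied to the differences \<open>F n - F (k + N)\<close>
  as \<open>k\<close> grows turns this into convergence in norm.\<close>

lemma fock_Cauchy_converges:
  assumes p: "1 \<le> p" and m: "0 < m" and F: "\<And>n. F n \<in> fock_space m p"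
    and Cauchy: "\<And>e. 0 < e \<Longrightarrow> \<exists>N. \<forall>n\<ge>N. \<forall>k\<ge>N. fock_dist m p (F n) (F k) < e"
  obtains g where "g \<in> fock_space m p" "(\<lambda>n. fock_dist m p (F n) g) \<longlonglongrightarrow> 0"
proof -
  define g where "g x = lim (\<lambda>n. F n x)" for x
  have unif: "uniform_limit (cball x 1) F g sequentially" for x
  proof -
    define C where "C = 2 * exp ((cmod x + 2) powr m)"
    have C: "0 < C" by (simp add: C_def)
    have "uniformly_Cauchy_on (cball x 1) F"
      unfolding uniformly_Cauchy_on_def
    proof (intro allI impI)
      fix e :: real assume "0 < e"
      then obtain N where N: "\<And>n k. n \<ge> N \<Longrightarrow> k \<ge> N \<Longrightarrow> fock_dist m p (F n) (F k) < e / C"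
        using Cauchy[of "e / C"] C by auto
      have "dist (F n z) (F k z) < e" if "z \<in> cball x 1" "n \<ge> N" "k \<ge> N" for z n k
      proof -
        have "cmod z \<le> cmod x + 1" using that(1) norm_triangle_ineq2[of z x] by (simp add: dist_norm norm_minus_commute)
        then have "2 * exp ((cmod z + 1) powr m) \<le> C"
          using m by (simp add: C_def powr_mono2)
        then have "2 * exp ((cmod z + 1) powr m) * fock_norm m p (\<lambda>z. F n z - F k z)
            \<le> C * fock_norm m p (\<lambda>z. F n z - F k z)" by (intro mult_right_mono fock_norm_nonneg)
        with fock_pointwise_bound[OF p m fock_space_diff[OF p F[of n] F[of k]], of z]
        have "cmod (F n z - F k z) \<le> C * fock_norm m p (\<lambda>z. F n z - F k z)" by linarith
        also have "\<dots> < e" using N[OF that(2,3)] C by (simp add: fock_dist_def field_simps)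
        finally show ?thesis by (simp add: dist_norm)
      qed
      then show "\<exists>M. \<forall>z\<in>cball x 1. \<forall>i\<ge>M. \<forall>n\<ge>M. dist (F i z) (F n z) < e" by blast
    qed
    then have "uniformly_convergent_on (cball x 1) F" by (rule Cauchy_uniformly_convergent)
    then show ?thesis unfolding uniformly_convergent_uniform_limit_iff g_def .
  qed
  have hol: "g holomorphic_on UNIV"
    by (rule holomorphic_uniform_sequence[OF open_UNIV, of F])
      (use unif F in \<open>auto intro!: exI[of _ "1::real"] fock_space_entire\<close>)
  have lim: "(\<lambda>n. F n z) \<longlonglongrightarrow> g z" for z
    using tendsto_uniform_limitI[OF unif[of z], of z] by simp
  have close: "\<exists>N. \<forall>n\<ge>N. (\<lambda>z. F n z - g z) \<in> fock_space m p \<and> fock_norm m p (\<lambda>z. F n z - g z) \<le> e"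
    if e: "0 < e" for e
  proof -
    obtain N where N: "\<And>n k. n \<ge> N \<Longrightarrow> k \<ge> N \<Longrightarrow> fock_dist m p (F n) (F k) < e"
      using Cauchy[OF e] by blast
    have "(\<lambda>z. F n z - g z) \<in> fock_space m p" "fock_norm m p (\<lambda>z. F n z - g z) \<le> e" if "n \<ge> N" for n
    proof -
      have hol': "(\<lambda>z. F n z - g z) holomorphic_on UNIV"
        using fock_space_entire[OF F] hol by (intro holomorphic_intros)
      have lim': "(\<lambda>k. F n z - F (k + N) z) \<longlonglongrightarrow> F n z - g z" for z
        by (intro tendsto_intros LIMSEQ_ignore_initial_segment lim)
      have bd: "fock_norm m p (\<lambda>z. F n z - F (k + N) z) \<le> e" for k
        using N[OF that, of "k + N"] by (simp add: fock_dist_def)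
      show "(\<lambda>z. F n z - g z) \<in> fock_space m p" "fock_norm m p (\<lambda>z. F n z - g z) \<le> e"
        using fock_norm_fatou[OF p fock_space_diff[OF p F F] bd lim' hol'] by auto
    qed
    then show ?thesis by blast
  qed
  show thesis
  proof (rule that)
    obtain N where "(\<lambda>z. F N z - g z) \<in> fock_space m p" using close[of 1] by auto
    from fock_space_diff[OF p F[of N] this] show "g \<in> fock_space m p" by simp
    show "(\<lambda>n. fock_dist m p (F n) g) \<longlonglongrightarrow> 0"
    proof (rule LIMSEQ_I)
      fix e :: real assume "0 < e"
      then obtain N where "\<forall>n\<ge>N. fock_norm m p (\<lambda>z. F n z - g z) \<le> e / 2" using close[of "e / 2"] by auto
      then have "\<forall>n\<ge>N. norm (fock_dist m p (F n) g - 0) < e"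
        using \<open>0 < e\<close> by (auto simp: fock_dist_def fock_norm_nonneg)
      then show "\<exists>N. \<forall>n\<ge>N. norm (fock_dist m p (F n) g - 0) < e" ..
    qed
  qed
qed

lemma mcomplete_fock:
  assumes "1 \<le> p" "0 < m"
  shows "Metric_space.mcomplete (fock_space m p) (fock_dist m p)"
proof -
  interpret Metric_space "fock_space m p" "fock_dist m p" by (rule Metric_space_fock[OF assms(1)])
  show ?thesis
    unfolding mcomplete_def
  proof (intro allI impI)
    fix F assume "MCauchy F"
    then have F: "F n \<in> fock_space m p" for n
      unfolding MCauchy_def by (simp add: image_subset_iff)
    have C: "\<exists>N. \<forall>n\<ge>N. \<forall>k\<ge>N. fock_dist m p (F n) (F k) < e" if e: "0 < e" for e
    proof -
      obtain N where "\<forall>n n'. N \<le> n \<longrightarrow> N \<le> n' \<longrightarrow> fock_dist m p (F n) (F n') < e"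
        using \<open>MCauchy F\<close> e unfolding MCauchy_def by meson
      then show ?thesis by (intro exI[of _ N]) simp
    qed
    from fock_Cauchy_converges[OF assms F C] obtain g
      where "g \<in> fock_space m p" "(\<lambda>n. fock_dist m p (F n) g) \<longlonglongrightarrow> 0" by blast
    then have lim: "limitin mtopology F g sequentially"
      unfolding limitin_metric_dist_null by (simp add: F)
    show "\<exists>x. limitin mtopology F x sequentially" using lim by (rule exI[of "\<lambda>x. limitin mtopology F x sequentially" g])
  qed
qed

section \<open>The lower bound from closed range\<close>

lemma has_field_derivative_entire:
  "f holomorphic_on UNIV \<Longrightarrow> (f has_field_derivative deriv f z) (at z)"
  by (rule holomorphic_derivI) auto

lemma deriv_add_cmult_entire:
  assumes "f holomorphic_on UNIV" "g holomorphic_on UNIV"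
  shows "deriv (\<lambda>z. f z + c * g z) = (\<lambda>z. deriv f z + c * deriv g z)"
  by (rule ext, rule DERIV_imp_deriv)
    (auto intro!: derivative_eq_intros has_field_derivative_entire assms)

lemma entire_eq_of_deriv_eq:
  assumes f: "f holomorphic_on UNIV" and g: "g holomorphic_on UNIV"
    and "deriv f = deriv g" "f 0 = g 0"
  shows "f = g"
proof
  fix z
  have "norm ((f z - g z) - (f 0 - g 0)) \<le> 0 * norm (z - 0)"
  proof (rule field_differentiable_bound[of UNIV "\<lambda>z. f z - g z" "\<lambda>z. deriv f z - deriv g z"])
    show "((\<lambda>z. f z - g z) has_field_derivative deriv f w - deriv g w) (at w within UNIV)" for w
      by (intro DERIV_diff has_field_derivative_entire f g)
  qed (use assms(3) in auto)
  then show "f z = g z" using assms(4) by simp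
qed

lemma fock_space_const:
  assumes "1 \<le> p" "0 < m"
  shows "(\<lambda>z. c) \<in> fock_space m p"
proof -
  obtain M where "0 < M" and M: "\<And>f A. f holomorphic_on UNIV \<Longrightarrow>
      (\<And>z. cmod (f z) \<le> A * exp (cmod z powr m / 2)) \<Longrightarrow> f \<in> fock_space m p \<and> fock_norm m p f \<le> A * M"
    using fock_dominated[OF assms] by metis
  have "cmod c \<le> cmod c * exp (cmod z powr m / 2)" for z
    using mult_left_mono[of 1 "exp (cmod z powr m / 2)" "cmod c"] by simp
  then show ?thesis using M[of "\<lambda>z. c" "cmod c"] by simp
qed

text \<open>Convergence of the derivatives in norm is locally uniform. Since all \<open>f k\<close>
  vanish at 0, integrating from 0 gives pointwise convergence of \<open>f k\<close> to the primitive
  of \<open>g\<close>, and the norm bound passes to the limit by Fatou. This says that D maps the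
  normalised part of a closed ball onto a closed set.\<close>

lemma fock_deriv_limit:
  assumes p: "1 \<le> p" and q: "1 \<le> q" and m: "0 < m"
    and f: "\<And>k. f k \<in> fock_space m p" "\<And>k. f k 0 = 0" "\<And>k. fock_norm m p (f k) \<le> B"
    and f': "\<And>k. deriv (f k) \<in> fock_space m q" and g: "g \<in> fock_space m q"
    and lim: "(\<lambda>k. fock_dist m q (deriv (f k)) g) \<longlonglongrightarrow> 0"
  obtains G where "G \<in> fock_space m p" "G 0 = 0" "fock_norm m p G \<le> B" "deriv G = g"
proof -
  obtain G0 where G0: "\<And>z. (G0 has_field_derivative g z) (at z)"
    using holomorphic_convex_primitive'[OF convex_UNIV open_UNIV fock_space_entire[OF g]] by auto
  define G where "G z = G0 z - G0 0" for z
  have G: "(G has_field_derivative g z) (at z)" for z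
    unfolding G_def using DERIV_diff[OF G0 DERIV_const] by simp
  have hol: "G holomorphic_on UNIV" unfolding holomorphic_on_open[OF open_UNIV] by (intro ballI exI) (rule G)
  have "(\<lambda>k. f k z) \<longlonglongrightarrow> G z" for z
  proof -
    define C where "C = 2 * exp ((cmod z + 1) powr m)"
    have "cmod (f k z - G z) \<le> C * cmod z * fock_dist m q (deriv (f k)) g" for k
    proof -
      have "cmod ((f k z - G z) - (f k 0 - G 0)) \<le> (C * fock_dist m q (deriv (f k)) g) * cmod (z - 0)"
      proof (rule field_differentiable_bound[of "cball 0 (cmod z)" "\<lambda>w. f k w - G w" "\<lambda>w. deriv (f k) w - g w"])
        show "((\<lambda>w. f k w - G w) has_field_derivative deriv (f k) w - g w) (at w within cball 0 (cmod z))" for w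
          by (intro DERIV_diff has_field_derivative_at_within[OF G]
              has_field_derivative_at_within[OF has_field_derivative_entire[OF fock_space_entire[OF f(1)]]])
        show "cmod (deriv (f k) w - g w) \<le> C * fock_dist m q (deriv (f k)) g" if "w \<in> cball 0 (cmod z)" for w
        proof -
          have "2 * exp ((cmod w + 1) powr m) \<le> C" using that m by (simp add: C_def powr_mono2)
          then have "2 * exp ((cmod w + 1) powr m) * fock_dist m q (deriv (f k)) g
              \<le> C * fock_dist m q (deriv (f k)) g"
            by (intro mult_right_mono) (simp_all add: fock_dist_def fock_norm_nonneg)
          with fock_pointwise_bound[OF q m fock_space_diff[OF q f' g], of k w] show ?thesis
            by (simp add: fock_dist_def)
        qed
      qed auto
      then show ?thesis by (simp add: f(2) G_def mult_ac)
    qed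
    moreover have "(\<lambda>k. C * cmod z * fock_dist m q (deriv (f k)) g) \<longlonglongrightarrow> 0"
      using tendsto_mult_left[OF lim, of "C * cmod z"] by simp
    ultimately have "(\<lambda>k. f k z - G z) \<longlonglongrightarrow> 0" by (rule Lim_null_comparison[OF always_eventually[OF allI]])
    then show ?thesis by (simp add: LIM_zero_iff)
  qed
  from fock_norm_fatou[OF p f(1,3) this hol] show thesis
    using that[of G] DERIV_imp_deriv[OF G] by (auto simp: G_def)
qed

text \<open>The Baire category argument of the open mapping theorem, run on the range of \<open>D\<close>.\<close>
lemma D_closed_range_lower_bound:
  assumes p: "1 \<le> p" and q: "1 \<le> q" and m: "0 < m"
    and D: "D_bounded m p q" and closed: "D_closed_range m p q"
  obtains K where "0 < K"
    "\<And>f. f \<in> fock_space m p \<Longrightarrow> f 0 = 0 \<Longrightarrow> fock_norm m p f \<le> K * fock_norm m q (deriv f)"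
proof -
  have Dq: "deriv f \<in> fock_space m q" if "f \<in> fock_space m p" for f
    using D that by (simp add: D_bounded_def)
  define Y where "Y = deriv ` fock_space m p"
  interpret M: Metric_space "fock_space m q" "fock_dist m q" by (rule Metric_space_fock[OF q])
  interpret Y: Submetric "fock_space m q" "fock_dist m q" Y
    by unfold_locales (auto simp: Y_def Dq)
  \<comment> \<open>Closed range enters here: a closed subset of a complete space is complete, so
    Baire's theorem is available inside the range itself.\<close>
  have complete: "Y.sub.mcomplete"
    using closed Y.closedin_mcomplete_imp_mcomplete[OF _ mcomplete_fock[OF q m]]
    by (simp add: D_closed_range_def fock_topology_def Y_def)
  \<comment> \<open>Countably many closed sets covering the range. The condition
    \<open>f 0 = 0\<close> makes the preimage of each derivative unique, which lets norms of
    preimages be read off below.\<close>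
  define E where "E n = deriv ` {f \<in> fock_space m p. f 0 = 0 \<and> fock_norm m p f \<le> real n}" for n
  have EY: "E n \<subseteq> Y" for n by (auto simp: E_def Y_def)
  have E_closed: "closedin Y.sub.mtopology (E n)" for n
    unfolding Y.sub.metric_closedin_iff_sequentially_closed
  proof (intro conjI allI impI EY)
    fix \<sigma> g assume *: "range \<sigma> \<subseteq> E n \<and> limitin Y.sub.mtopology \<sigma> g sequentially"
    then have "\<forall>k. \<exists>f. f \<in> fock_space m p \<and> f 0 = 0 \<and> fock_norm m p f \<le> real n \<and> \<sigma> k = deriv f"
      unfolding E_def by auto
    then obtain f where f: "\<And>k. f k \<in> fock_space m p" "\<And>k. f k 0 = 0"
      "\<And>k. fock_norm m p (f k) \<le> real n" "\<And>k. \<sigma> k = deriv (f k)" by metis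
    have lim: "limitin M.mtopology \<sigma> g sequentially" using * Y.limitin_submetric_iff by blast
    have g: "g \<in> fock_space m q" using lim M.limitin_mspace by blast
    have "(\<lambda>k. fock_dist m q (deriv (f k)) g) \<longlonglongrightarrow> 0"
      using lim by (simp add: M.limitin_metric_dist_null f(4))
    from fock_deriv_limit[OF p q m f(1-3) Dq[OF f(1)] g this] show "g \<in> E n"
      unfolding E_def by blast
  qed
  have normalize: "\<exists>h \<in> fock_space m p. h 0 = 0 \<and> deriv h = deriv f" if f: "f \<in> fock_space m p" for f
  proof (intro bexI conjI)
    show "(\<lambda>z. f z - f 0) \<in> fock_space m p" by (intro fock_space_diff p f fock_space_const m)
    show "deriv (\<lambda>z. f z - f 0) = deriv f"
      using deriv_add_cmult_entire[OF fock_space_entire[OF f], of "\<lambda>z. f 0" "-1"] by simp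
  qed simp
  have cover: "\<Union> (range E) = Y"
  proof
    show "Y \<subseteq> \<Union> (range E)"
    proof
      fix y assume "y \<in> Y"
      then obtain h where "h \<in> fock_space m p" "h 0 = 0" "y = deriv h"
        using normalize unfolding Y_def by fastforce
      moreover obtain n where "fock_norm m p h \<le> real n" using real_arch_simple by blast
      ultimately show "y \<in> \<Union> (range E)" unfolding E_def by blast
    qed
  qed (use EY in blast)
  have "Y \<noteq> {}" using fock_space_const[OF p m, of 0] by (auto simp: Y_def)
  have "\<exists>n. Y.sub.mtopology interior_of (E n) \<noteq> {}"
  proof (rule ccontr)
    assume "\<nexists>n. Y.sub.mtopology interior_of (E n) \<noteq> {}"
    then have "Y.sub.mtopology interior_of \<Union> (range E) = {}"
      using E_closed by (intro Y.sub.metric_Baire_category_alt complete) auto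
    then have "Y.sub.mtopology interior_of Y = {}" by (simp only: cover)
    then show False using \<open>Y \<noteq> {}\<close> interior_of_topspace[of Y.sub.mtopology] by simp
  qed
  then obtain n g0 \<epsilon> where "g0 \<in> Y" "0 < \<epsilon>" and ball: "Y.sub.mball g0 \<epsilon> \<subseteq> E n"
    unfolding Y.sub.metric_interior_of by blast
  from \<open>g0 \<in> Y\<close> \<open>0 < \<epsilon>\<close> ball have "g0 \<in> E n" using Y.sub.centre_in_mball_iff by blast
  then obtain f0 where f0: "f0 \<in> fock_space m p" "f0 0 = 0" "fock_norm m p f0 \<le> n" "g0 = deriv f0"
    by (auto simp: E_def)
  show thesis
  \<comment> \<open>Two preimages of norm at most \<open>n\<close> are subtracted and the result is
    divided by the scaling factor \<epsilon> / (2 N) used below, N being the norm of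
    \<open>deriv f\<close>: this gives 4 n N / \<epsilon>. Using \<open>n + 1\<close> keeps the
    constant positive when \<open>n = 0\<close>.\<close>
  proof (rule that[of "4 * (real n + 1) / \<epsilon>"])
    fix f assume f: "f \<in> fock_space m p" and "f 0 = 0"
    define N where "N = fock_norm m q (deriv f)"
    show "fock_norm m p f \<le> 4 * (real n + 1) / \<epsilon> * fock_norm m q (deriv f)"
    proof (cases "N = 0")
      case True
      then have "deriv f = (\<lambda>z. 0)" using fock_norm_eq_0D[OF q Dq[OF f]] by (auto simp: N_def)
      then have "f = (\<lambda>z. 0)"
        by (intro entire_eq_of_deriv_eq[OF fock_space_entire[OF f] holomorphic_on_const] ) (simp_all add: \<open>f 0 = 0\<close>)
      then show ?thesis using \<open>0 < \<epsilon>\<close> by (simp add: fock_norm_zero fock_norm_nonneg)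
    next
      case False
      then have N: "0 < N" using fock_norm_nonneg[of m q "deriv f"] by (simp add: N_def)
      \<comment> \<open>The multiple of \<open>deriv f\<close> by \<open>c\<close> has norm
        \<epsilon> / 2, so adding it to the centre \<open>g0\<close> stays inside the ball.\<close>
      define c where "c = \<epsilon> / (2 * N)"
      have c: "0 < c" using N \<open>0 < \<epsilon>\<close> by (simp add: c_def)
      note hf = fock_space_entire[OF f] and hf0 = fock_space_entire[OF f0(1)]
      note cf = fock_norm_cmult[OF p f, of "of_real c"] and cf' = fock_norm_cmult[OF q Dq[OF f], of "of_real c"]
      define g where "g = deriv (\<lambda>z. f0 z + of_real c * f z)"
      have g: "g = (\<lambda>z. g0 z + of_real c * deriv f z)"
        unfolding g_def f0(4) by (rule deriv_add_cmult_entire[OF hf0 hf])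
      have "g \<in> Y" unfolding Y_def g_def using fock_norm_add(1)[OF p f0(1) cf(1)] by blast
      moreover have "fock_dist m q g0 g = c * N"
        using cf'(2) c by (subst fock_dist_commute) (simp add: fock_dist_def g N_def)
      moreover have "c * N < \<epsilon>" using N \<open>0 < \<epsilon>\<close> by (simp add: c_def)
      ultimately have "g \<in> E n" using ball \<open>g0 \<in> Y\<close> Y.sub.in_mball by auto
      then obtain h where h: "h \<in> fock_space m p" "h 0 = 0" "fock_norm m p h \<le> n" "g = deriv h"
        by (auto simp: E_def)
      \<comment> \<open>Both sides have derivative \<open>g\<close> and vanish at 0. Hence
        \<open>c * f\<close> is the difference of two preimages with controlled norm.\<close>
      have "h = (\<lambda>z. f0 z + of_real c * f z)"
      proof (rule entire_eq_of_deriv_eq)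
        show "deriv h = deriv (\<lambda>z. f0 z + of_real c * f z)" using h(4) by (simp add: g_def)
      qed (use fock_space_entire[OF h(1)] h(2) f0(2) \<open>f 0 = 0\<close> hf hf0 in \<open>auto intro!: holomorphic_intros\<close>)
      then have "(\<lambda>z. of_real c * f z) = (\<lambda>z. h z - f0 z)" by auto
      then have "c * fock_norm m p f \<le> real n + real n"
        using cf(2) c fock_norm_diff[OF p h(1) f0(1)] h(3) f0(3) by simp
      also have "\<dots> \<le> 2 * (real n + 1)" by simp
      finally have "fock_norm m p f \<le> 2 * (real n + 1) / c" using c by (simp add: field_simps)
      also have "\<dots> = 4 * (real n + 1) / \<epsilon> * N" by (simp add: c_def)
      finally show ?thesis by (simp add: N_def)
    qed
  qed (use \<open>0 < \<epsilon>\<close> in auto)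
qed

section \<open>Norms of monomials\<close>

text \<open>\<open>powr_le_const_exp\<close> in the variable |z|^m, with exponent
  \<open>n / m\<close> and rate 1/2, which is the form that \<open>fock_dominated\<close>
  accepts.\<close>

lemma cmod_power_le_exp:
  assumes "0 < m" "0 < n"
  shows "cmod (z ^ n) \<le> (2 * real n / m) powr (real n / m) * exp (cmod z powr m / 2)"
proof -
  have "cmod (z ^ n) = (cmod z powr m) powr (real n / m)"
    using assms by (cases "z = 0") (simp_all add: norm_power powr_powr powr_realpow)
  also have "\<dots> \<le> (real n / m / (1/2)) powr (real n / m) * exp (1/2 * cmod z powr m)"
    using assms by (intro powr_le_const_exp) auto
  finally show ?thesis by (simp add: mult.commute)
qed

lemma monomial_norm_upper:
  assumes "1 \<le> p" "0 < m"
  obtains M where "0 < M"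
    "\<And>n. 0 < n \<Longrightarrow> fock_norm m p (\<lambda>z. z ^ n) \<le> (2 * real n / m) powr (real n / m) * M"
    "\<And>n. (\<lambda>z. z ^ n) \<in> fock_space m p"
proof -
  obtain M where "0 < M" and M: "\<And>f A. f holomorphic_on UNIV \<Longrightarrow>
      (\<And>z. cmod (f z) \<le> A * exp (cmod z powr m / 2)) \<Longrightarrow> f \<in> fock_space m p \<and> fock_norm m p f \<le> A * M"
    using fock_dominated[OF assms] by metis
  have *: "(\<lambda>z. z ^ n) \<in> fock_space m p \<and>
      fock_norm m p (\<lambda>z. z ^ n) \<le> (2 * real n / m) powr (real n / m) * M" if "0 < n" for n
    by (rule M) (use cmod_power_le_exp[OF assms(2) that] in \<open>auto intro!: holomorphic_intros\<close>)
  show thesis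
  proof (rule that[OF \<open>0 < M\<close>])
    show "(\<lambda>z. z ^ n) \<in> fock_space m p" for n
      using *[of n] fock_space_const[OF assms, of 1] by (cases "n = 0") auto
  qed (use * in blast)
qed

lemma monomial_in_fock_space: "1 \<le> p \<Longrightarrow> 0 < m \<Longrightarrow> (\<lambda>z. z ^ n) \<in> fock_space m p"
  by (erule (1) monomial_norm_upper) blast

lemma power_le_monomial_norm:
  assumes "1 \<le> p" "0 < m" "0 \<le> R"
  shows "R ^ n \<le> 2 * exp ((R + 1) powr m) * fock_norm m p (\<lambda>z. z ^ n)"
  using fock_pointwise_bound[OF assms(1,2) monomial_in_fock_space[OF assms(1,2)], where z = "of_real R"] assms(3)
  by (simp add: norm_power)

text \<open>The point evaluation is taken at radius R = n^(1/m), where R^n = n^(n/m), while (R +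
  1)^m \<le> (2 R)^m = 2^m n costs only an exponential factor.\<close>

lemma monomial_norm_lower:
  assumes "1 \<le> p" "0 < m" "0 < n"
  shows "real n powr (real n / m) \<le> 2 * exp (2 powr m) ^ n * fock_norm m p (\<lambda>z. z ^ n)"
proof -
  define R where "R = real n powr (1 / m)"
  have R: "1 \<le> R" unfolding R_def using assms by (intro ge_one_powr_ge_zero) auto
  have "R ^ n = real n powr (real n / m)"
    using R assms by (simp add: R_def powr_powr flip: powr_realpow)
  moreover have "exp ((R + 1) powr m) \<le> exp (2 powr m) ^ n"
  proof -
    have "(R + 1) powr m \<le> (2 * R) powr m" using R assms by (intro powr_mono2) auto
    also have "\<dots> = 2 powr m * real n" using assms by (simp add: R_def powr_mult powr_powr)
    finally show ?thesis by (simp add: mult.commute flip: exp_of_nat_mult)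
  qed
  then have "2 * exp ((R + 1) powr m) * fock_norm m p (\<lambda>z. z ^ n)
      \<le> 2 * exp (2 powr m) ^ n * fock_norm m p (\<lambda>z. z ^ n)"
    by (intro mult_right_mono mult_left_mono) (auto simp: fock_norm_nonneg)
  ultimately show ?thesis
    using power_le_monomial_norm[OF assms(1,2), of R n] R by simp
qed

lemma monomial_norm_pos:
  assumes "1 \<le> p" "0 < m"
  shows "0 < fock_norm m p (\<lambda>z. z ^ n)"
proof (rule ccontr)
  assume "\<not> 0 < fock_norm m p (\<lambda>z. z ^ n)"
  then have "fock_norm m p (\<lambda>z. z ^ n) = 0" using fock_norm_nonneg[of m p "\<lambda>z. z ^ n"] by linarith
  from fock_norm_eq_0D[OF assms(1) monomial_in_fock_space[OF assms] this, of 1] show False by simp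
qed

section \<open>Growth rates and the exponent \<open>m\<close>\<close>

text \<open>The elementary half of Stirling's formula. From n to n + 1 the left side gains the
  factor (n + 1)(1 + 1/n)^n and the right side (n + 1) e.\<close>

lemma power_self_le_fact_exp: "real n ^ n \<le> fact n * exp 1 ^ n"
proof (induction n)
  case (Suc n)
  show ?case
  proof (cases "n = 0")
    case False
    have "1 + 1 / real n \<le> exp (1 / real n)" by (rule exp_ge_add_one_self)
    then have "(1 + 1 / real n) ^ n \<le> exp (1 / real n) ^ n" by (intro power_mono) auto
    also have "\<dots> = exp 1" using False by (simp flip: exp_of_nat_mult)
    finally have e: "(1 + 1 / real n) ^ n \<le> exp 1" .
    have "real (Suc n) ^ Suc n = real (Suc n) * (real n * (1 + 1 / real n)) ^ n"
      using False by (simp add: distrib_left add.commute)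
    also have "\<dots> = real (Suc n) * (real n ^ n * (1 + 1 / real n) ^ n)" by (simp only: power_mult_distrib)
    also have "\<dots> \<le> real (Suc n) * ((fact n * exp 1 ^ n) * exp 1)"
      by (intro mult_left_mono mult_mono Suc.IH e) auto
    finally show ?thesis by (simp add: mult_ac)
  qed (use exp_ge_add_one_self[of "1::real"] in simp)
qed simp

text \<open>For s > 0 the base of (n^s)^n eventually exceeds 2 B, which would force 2^n \<le> A for
  all large n. This separates growth of type n^(sn) from arbitrary exponential factors.\<close>

lemma powr_growth_nonpos:
  fixes s A B :: real
  assumes "0 < B" and le: "\<And>n::nat. 0 < n \<Longrightarrow> real n powr (real n * s) \<le> A * B ^ n"
  shows "s \<le> 0"
proof (rule ccontr)
  assume "\<not> s \<le> 0"
  then have s: "0 < s" by simp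
  obtain k where k: "A < 2 ^ k" using real_arch_pow[of 2 A] by auto
  obtain j where j: "(2 * B) powr (1 / s) \<le> real j" using real_arch_simple by blast
  \<comment> \<open>Large enough for 2^n > A (through \<open>k\<close>) and for n^s \<ge> 2 B
    (through \<open>j\<close>), and positive.\<close>
  define n where "n = max (max k j) 1"
  have n: "0 < n" "k \<le> n" "j \<le> n" by (auto simp: n_def)
  have "((2 * B) powr (1 / s)) powr s \<le> real n powr s"
    using s j n by (intro powr_mono2) auto
  then have "2 * B \<le> real n powr s" using s assms(1) by (simp add: powr_powr)
  then have "(2 * B) ^ n \<le> (real n powr s) ^ n" using assms(1) by (intro power_mono) auto
  also have "\<dots> = real n powr (real n * s)" using n by (simp add: powr_powr mult.commute flip: powr_realpow)
  also have "\<dots> \<le> A * B ^ n" using le n by simp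
  finally have "2 ^ n \<le> A" using assms(1) by (simp add: power_mult_distrib)
  moreover have "(2::real) ^ k \<le> 2 ^ n" using n by (intro power_increasing) auto
  ultimately show False using k by linarith
qed

lemma deriv_monomial: "deriv (\<lambda>z::complex. z ^ n) = (\<lambda>z. of_nat n * z ^ (n - 1))"
  by (rule ext, rule DERIV_imp_deriv) (auto intro!: derivative_eq_intros)

text \<open>On \<open>z ^ Suc n\<close> the two estimates confine the ratio of consecutive monomial
  norms between constant multiples of \<open>Suc n\<close>. Each of them, paired with the opposite
  direct bound on monomial norms, yields one of the two inequalities for \<open>m\<close>.\<close>

lemma exponent_eq_1_of_two_sided:
  assumes p: "1 \<le> p" and m: "0 < m" and D: "D_bounded m p p" and K: "0 < K"
    and lower: "\<And>f. f \<in> fock_space m p \<Longrightarrow> f 0 = 0 \<Longrightarrow> fock_norm m p f \<le> K * fock_norm m p (deriv f)"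
  shows "m = 1"
proof -
  obtain C0 where C0: "\<And>f. f \<in> fock_space m p \<Longrightarrow> fock_norm m p (deriv f) \<le> C0 * fock_norm m p f"
    using D by (auto simp: D_bounded_def)
  \<comment> \<open>The constant in the definition of boundedness carries no sign; this one is
    positive.\<close>
  define C where "C = \<bar>C0\<bar> + 1"
  define a where "a n = fock_norm m p (\<lambda>z. z ^ n)" for n :: nat
  have a: "0 < a n" for n unfolding a_def by (rule monomial_norm_pos[OF p m])
  have C: "0 < C" by (simp add: C_def)
  have D': "fock_norm m p (deriv (\<lambda>z. z ^ Suc n)) = real (Suc n) * a n" for n
    unfolding deriv_monomial a_def
    using fock_norm_cmult(2)[OF p monomial_in_fock_space[OF p m], of "of_nat (Suc n)" n]
    by (simp only: norm_of_nat diff_Suc_1)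
  have up: "real (Suc n) * a n \<le> C * a (Suc n)" for n
  proof -
    have "real (Suc n) * a n \<le> C0 * a (Suc n)"
      using C0[OF monomial_in_fock_space[OF p m], of "Suc n"] unfolding D' a_def .
    also have "\<dots> \<le> C * a (Suc n)" using less_imp_le[OF a] by (intro mult_right_mono) (auto simp: C_def)
    finally show ?thesis .
  qed
  have low: "a (Suc n) \<le> K * (real (Suc n) * a n)" for n
    using lower[OF monomial_in_fock_space[OF p m], of "Suc n"] unfolding D' a_def by simp
  have fact_le: "fact n * a 0 \<le> C ^ n * a n" for n
  proof (induction n)
    case (Suc n)
    have "fact (Suc n) * a 0 = real (Suc n) * (fact n * a 0)" by simp
    also have "\<dots> \<le> real (Suc n) * (C ^ n * a n)" by (intro mult_left_mono Suc.IH) auto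
    also have "\<dots> = C ^ n * (real (Suc n) * a n)" by simp
    also have "\<dots> \<le> C ^ n * (C * a (Suc n))" using C by (intro mult_left_mono up) auto
    finally show ?case by (simp add: mult_ac)
  qed simp
  have le_fact: "a n \<le> K ^ n * (fact n * a 0)" for n
  proof (induction n)
    case (Suc n)
    have "a (Suc n) \<le> K * (real (Suc n) * a n)" by (rule low)
    also have "\<dots> \<le> K * (real (Suc n) * (K ^ n * (fact n * a 0)))"
      using K by (intro mult_left_mono Suc.IH) auto
    finally show ?case by (simp add: mult_ac)
  qed simp
  obtain M where M: "0 < M" "\<And>n. 0 < n \<Longrightarrow> a n \<le> (2 * real n / m) powr (real n / m) * M"
    using monomial_norm_upper[OF p m] unfolding a_def by metis
  \<comment> \<open>Boundedness of D makes the norms grow at least factorially, so n^n is at most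
    n^(n/m) up to exponential factors: \<open>m \<le> 1\<close>.\<close>
  have "1 - 1 / m \<le> 0"
  proof (rule powr_growth_nonpos[of "exp 1 * C * (2 / m) powr (1 / m)" _ "M / a 0"])
    show "0 < exp 1 * C * (2 / m) powr (1 / m)" using C m by simp
    fix n :: nat assume n: "0 < n"
    have "real n powr real n * a 0 \<le> (fact n * exp 1 ^ n) * a 0"
      using power_self_le_fact_exp[of n] less_imp_le[OF a[of 0]] n
      by (intro mult_right_mono) (simp_all add: powr_realpow)
    also have "\<dots> = exp 1 ^ n * (fact n * a 0)" by simp
    also have "\<dots> \<le> exp 1 ^ n * (C ^ n * a n)" by (intro mult_left_mono fact_le) auto
    also have "\<dots> \<le> exp 1 ^ n * (C ^ n * ((2 * real n / m) powr (real n / m) * M))"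
      using C n by (intro mult_left_mono M) auto
    also have "(2 * real n / m) powr (real n / m) = ((2 / m) powr (1 / m)) ^ n * real n powr (real n / m)"
    proof -
      have "(2 * real n / m) powr (real n / m) = (2 / m * real n) powr (real n / m)" by simp
      also have "\<dots> = (2 / m) powr (real n / m) * real n powr (real n / m)"
        using m by (intro powr_mult) 
      also have "(2 / m) powr (real n / m) = ((2 / m) powr (1 / m)) ^ n"
        using m by (simp add: powr_powr flip: powr_realpow)
      finally show ?thesis .
    qed
    finally have "real n powr real n * a 0
        \<le> M * (exp 1 * C * (2 / m) powr (1 / m)) ^ n * real n powr (real n / m)"
      by (simp add: power_mult_distrib mult_ac)
    then have "real n powr real n / real n powr (real n / m) \<le> M * (exp 1 * C * (2 / m) powr (1 / m)) ^ n / a 0"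
      using n a[of 0] by (simp add: field_simps)
    then show "real n powr (real n * (1 - 1 / m)) \<le> M / a 0 * (exp 1 * C * (2 / m) powr (1 / m)) ^ n"
      using n by (simp add: right_diff_distrib powr_diff)
  qed
  \<comment> \<open>The lower bound for D makes the norms grow at most factorially, so n^(n/m) is at
    most n^n up to exponential factors: \<open>m \<ge> 1\<close>.\<close>
  moreover have "1 / m - 1 \<le> 0"
  proof (rule powr_growth_nonpos[of "exp (2 powr m) * K" _ "2 * a 0"])
    show "0 < exp (2 powr m) * K" using K by simp
    fix n :: nat assume n: "0 < n"
    have "real n powr (real n / m) \<le> 2 * exp (2 powr m) ^ n * a n"
      unfolding a_def by (rule monomial_norm_lower[OF p m n])
    also have "\<dots> \<le> 2 * exp (2 powr m) ^ n * (K ^ n * (fact n * a 0))"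
      by (intro mult_left_mono le_fact) auto
    also have "\<dots> \<le> 2 * exp (2 powr m) ^ n * (K ^ n * (real n powr real n * a 0))"
    proof -
      have "(fact n :: real) \<le> real (n ^ n)" by (rule fact_le_power)
      then have "(fact n :: real) \<le> real n powr real n" using n by (simp add: powr_realpow)
      then show ?thesis using K less_imp_le[OF a[of 0]] by (intro mult_left_mono mult_right_mono) auto
    qed
    finally have "real n powr (real n / m) / real n powr real n \<le> 2 * a 0 * (exp (2 powr m) * K) ^ n"
      using n by (simp add: field_simps power_mult_distrib)
    then show "real n powr (real n * (1 / m - 1)) \<le> 2 * a 0 * (exp (2 powr m) * K) ^ n"
      using n by (simp add: right_diff_distrib powr_diff)
  qed
  ultimately show ?thesis using m by (simp add: field_simps)
qed

section \<open>Sparse sums\<close>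

text \<open>The assumptions on \<open>s\<close> are the triangle inequalities for the modulus of a
  sum with summands of moduli \<open>x\<close> and \<open>y\<close>; they place \<open>s\<close>
  within the minimum of the maximum. The convexity inequality then moves the minimum into an error
  term, and the factor (1 - t)^(1 - r) left on the main term tends to 1 as \<open>t\<close> tends to
  0. The extra 1 in the second estimate pays for the smaller of the two powers on its left
  side.\<close>

lemma powr_almost_additive_pointwise:
  fixes r t x y s :: real
  assumes r: "1 \<le> r" and t: "0 < t" "t < 1" and xy: "0 \<le> x" "0 \<le> y"
    and s: "0 \<le> s" "s \<le> x + y" "x \<le> s + y" "y \<le> s + x"
  shows "s powr r \<le> (1 - t) powr (1 - r) * (x powr r + y powr r) + t powr (1 - r) * min x y powr r"
    and "x powr r + y powr r \<le> (1 - t) powr (1 - r) * s powr r + (t powr (1 - r) + 1) * min x y powr r"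
proof -
  let ?L = "(1 - t) powr (1 - r)" and ?T = "t powr (1 - r)"
  \<comment> \<open>The weights \<open>1 - t\<close> and \<open>t\<close> add up to 1, so the
    prefactor of the general inequality disappears.\<close>
  have mink: "(u + v) powr r \<le> ?L * u powr r + ?T * v powr r" if "0 \<le> u" "0 \<le> v" for u v
    using fock_minkowski_pointwise[of "1 - t" t u v r] t r that by simp
  define \<mu> M where "\<mu> = min x y" and "M = max x y"
  have \<mu>: "0 \<le> \<mu>" "0 \<le> M" "x + y = M + \<mu>" "M \<le> s + \<mu>" "x powr r + y powr r = M powr r + \<mu> powr r"
    using xy s by (auto simp: \<mu>_def M_def min_def max_def)
  have "s powr r \<le> (M + \<mu>) powr r" using s \<mu> r by (intro powr_mono2) auto
  also have "\<dots> \<le> ?L * M powr r + ?T * \<mu> powr r" by (rule mink) (use \<mu> in auto)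
  also have "\<dots> \<le> ?L * (x powr r + y powr r) + ?T * \<mu> powr r"
    unfolding \<mu>(5) by (simp add: mult_left_mono)
  finally show "s powr r \<le> ?L * (x powr r + y powr r) + ?T * min x y powr r" by (simp add: \<mu>_def)
  have "M powr r \<le> (s + \<mu>) powr r" using s \<mu> r by (intro powr_mono2) auto
  also have "\<dots> \<le> ?L * s powr r + ?T * \<mu> powr r" by (rule mink) (use s \<mu> in auto)
  finally have "x powr r + y powr r \<le> ?L * s powr r + ?T * \<mu> powr r + \<mu> powr r" using \<mu>(5) by simp
  then show "x powr r + y powr r \<le> ?L * s powr r + (?T + 1) * min x y powr r"
    by (simp add: \<mu>_def distrib_right)
qed

lemma fock_weighted_triangle:
  shows "fock_weighted m (\<lambda>z. f z + g z) z \<le> fock_weighted m f z + fock_weighted m g z"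
    and "fock_weighted m f z \<le> fock_weighted m (\<lambda>z. f z + g z) z + fock_weighted m g z"
    and "fock_weighted m g z \<le> fock_weighted m (\<lambda>z. f z + g z) z + fock_weighted m f z"
proof -
  have *: "a * exp (- (cmod z powr m)) \<le> b * exp (- (cmod z powr m)) + c * exp (- (cmod z powr m))"
    if "a \<le> b + c" for a b c
    using mult_right_mono[OF that, of "exp (- (cmod z powr m))"] by (simp add: distrib_right)
  show "fock_weighted m (\<lambda>z. f z + g z) z \<le> fock_weighted m f z + fock_weighted m g z"
    unfolding fock_weighted_def by (intro * norm_triangle_ineq)
  show "fock_weighted m f z \<le> fock_weighted m (\<lambda>z. f z + g z) z + fock_weighted m g z"
    unfolding fock_weighted_def using norm_triangle_ineq4[of "f z + g z" "g z"] by (intro *) simp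
  show "fock_weighted m g z \<le> fock_weighted m (\<lambda>z. f z + g z) z + fock_weighted m f z"
    unfolding fock_weighted_def using norm_triangle_ineq4[of "f z + g z" "f z"] by (intro *) simp
qed

text \<open>The pointwise estimates integrated; \<open>I\<close> measures the overlap of
  \<open>f\<close> and \<open>g\<close>. The parameter \<open>t\<close> stays free because it has to
  be fixed before the overlap is made small.\<close>

lemma fock_norm_almost_additive:
  assumes r: "1 \<le> r" and t: "0 < t" "t < 1"
    and f: "f \<in> fock_space m (ennreal r)" and g: "g \<in> fock_space m (ennreal r)"
    and I: "(\<integral>\<^sup>+ z. ennreal (min (fock_weighted m f z) (fock_weighted m g z) powr r) \<partial>lborel) = ennreal I" "0 \<le> I"
  shows "fock_norm m (ennreal r) (\<lambda>z. f z + g z) powr r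
      \<le> (1 - t) powr (1 - r) * (fock_norm m (ennreal r) f powr r + fock_norm m (ennreal r) g powr r)
        + t powr (1 - r) * I"
    and "fock_norm m (ennreal r) f powr r + fock_norm m (ennreal r) g powr r
      \<le> (1 - t) powr (1 - r) * fock_norm m (ennreal r) (\<lambda>z. f z + g z) powr r
        + (t powr (1 - r) + 1) * I"
proof -
  define L T where "L = (1 - t) powr (1 - r)" and "T = t powr (1 - r)"
  have LT: "0 \<le> L" "0 \<le> T" by (auto simp: L_def T_def)
  have p: "1 \<le> ennreal r" using r by simp
  have fg: "(\<lambda>z. f z + g z) \<in> fock_space m (ennreal r)" by (rule fock_norm_add(1)[OF p f g])
  have [measurable]: "f \<in> borel_measurable borel" "g \<in> borel_measurable borel"
    "(\<lambda>z. f z + g z) \<in> borel_measurable borel"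
    using f g fg by (auto intro!: borel_measurable_entire fock_space_entire)
  define x y s \<mu> where "x = (\<lambda>z. fock_weighted m f z)" and "y = (\<lambda>z. fock_weighted m g z)"
    and "s = (\<lambda>z. fock_weighted m (\<lambda>z. f z + g z) z)" and "\<mu> = (\<lambda>z. min (x z) (y z))"
  have [measurable]: "x \<in> borel_measurable borel" "y \<in> borel_measurable borel"
    "s \<in> borel_measurable borel" "\<mu> \<in> borel_measurable borel"
    unfolding x_def y_def s_def \<mu>_def by measurable
  define X Y S where "X = fock_norm m (ennreal r) f powr r" and "Y = fock_norm m (ennreal r) g powr r"
    and "S = fock_norm m (ennreal r) (\<lambda>z. f z + g z) powr r"
  have XYS: "0 \<le> X" "0 \<le> Y" "0 \<le> S" by (auto simp: X_def Y_def S_def)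
  have int: "(\<integral>\<^sup>+ z. ennreal (x z powr r) \<partial>lborel) = ennreal X"
    "(\<integral>\<^sup>+ z. ennreal (y z powr r) \<partial>lborel) = ennreal Y"
    "(\<integral>\<^sup>+ z. ennreal (s z powr r) \<partial>lborel) = ennreal S"
    "(\<integral>\<^sup>+ z. ennreal (\<mu> z powr r) \<partial>lborel) = ennreal I"
    using fock_int_eq_norm_powr[OF r f] fock_int_eq_norm_powr[OF r g] fock_int_eq_norm_powr[OF r fg] I
    by (simp_all add: fock_int_eq x_def y_def s_def \<mu>_def X_def Y_def S_def)
  have pt: "s z powr r \<le> L * (x z powr r + y z powr r) + T * \<mu> z powr r"
    "x z powr r + y z powr r \<le> L * s z powr r + (T + 1) * \<mu> z powr r" for z
    unfolding L_def T_def \<mu>_def x_def y_def s_def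
    by (intro powr_almost_additive_pointwise r t fock_weighted_nonneg fock_weighted_triangle)+
  have "ennreal S \<le> (\<integral>\<^sup>+ z. ennreal L * (ennreal (x z powr r) + ennreal (y z powr r)) + ennreal T * ennreal (\<mu> z powr r) \<partial>lborel)"
    unfolding int(3)[symmetric] using pt(1) LT
    by (intro nn_integral_mono) (simp add: ennreal_leI flip: ennreal_plus ennreal_mult)
  also have "\<dots> = ennreal (L * (X + Y) + T * I)"
    using LT XYS I(2) by (simp add: nn_integral_add nn_integral_cmult int ennreal_mult)
  finally have 1: "S \<le> L * (X + Y) + T * I" using LT XYS I(2) by (subst (asm) ennreal_le_iff) auto
  have "ennreal (X + Y) = (\<integral>\<^sup>+ z. ennreal (x z powr r) + ennreal (y z powr r) \<partial>lborel)"
    using XYS by (simp add: nn_integral_add int)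
  also have "\<dots> \<le> (\<integral>\<^sup>+ z. ennreal L * ennreal (s z powr r) + ennreal (T + 1) * ennreal (\<mu> z powr r) \<partial>lborel)"
    using pt(2) LT by (intro nn_integral_mono) (simp add: ennreal_leI flip: ennreal_plus ennreal_mult)
  also have "\<dots> = ennreal (L * S + (T + 1) * I)"
    using LT XYS I(2) by (simp add: nn_integral_add nn_integral_cmult int ennreal_mult)
  finally have 2: "X + Y \<le> L * S + (T + 1) * I" using LT XYS I(2) by (subst (asm) ennreal_le_iff) auto
  show "fock_norm m (ennreal r) (\<lambda>z. f z + g z) powr r
      \<le> (1 - t) powr (1 - r) * (fock_norm m (ennreal r) f powr r + fock_norm m (ennreal r) g powr r)
        + t powr (1 - r) * I"
    using 1 by (simp only: S_def X_def Y_def L_def T_def)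
  show "fock_norm m (ennreal r) f powr r + fock_norm m (ennreal r) g powr r
      \<le> (1 - t) powr (1 - r) * fock_norm m (ennreal r) (\<lambda>z. f z + g z) powr r
        + (t powr (1 - r) + 1) * I"
    using 2 by (simp only: S_def X_def Y_def L_def T_def)
qed

text \<open>The Brezis-Lieb lemma: the cross terms are dominated by the \<open>r\<close>-th power of the minimum of the
  two weighted moduli, whose integral tends to \<open>0\<close>.\<close>
lemma fock_norm_eventually_additive:
  assumes r: "1 \<le> r" and f: "f \<in> fock_space m (ennreal r)"
    and g: "\<And>n. g n \<in> fock_space m (ennreal r)" "\<And>n. fock_norm m (ennreal r) (g n) \<le> B"
    and lim: "\<And>z. (\<lambda>n. g n z) \<longlonglongrightarrow> 0" and \<delta>: "0 < \<delta>"
  shows "\<forall>\<^sub>F n in sequentially. \<bar>fock_norm m (ennreal r) (\<lambda>z. f z + g n z) powr r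
      - (fock_norm m (ennreal r) f powr r + fock_norm m (ennreal r) (g n) powr r)\<bar> \<le> \<delta>"
proof -
  have p: "1 \<le> ennreal r" using r by simp
  define X where "X = fock_norm m (ennreal r) f"
  \<comment> \<open>A bound, uniform in \<open>n\<close>, for both quantities that get multiplied by
    (1 - t)^(1 - r) - 1. It allows \<open>t\<close> to be chosen before \<open>n\<close>, at the
    expense of half of \<delta>.\<close>
  define P where "P = X powr r + B powr r + (X + B) powr r"
  have B: "0 \<le> B" by (rule order_trans[OF fock_norm_nonneg g(2)])
  have P: "0 \<le> P" by (simp add: P_def)
  have "((\<lambda>t. ((1 - t) powr (1 - r) - 1) * P) \<longlongrightarrow> ((1 - 0) powr (1 - r) - 1) * P) (at_right 0)"
    by (intro tendsto_intros) auto
  then have "\<forall>\<^sub>F t in at_right 0. ((1 - t) powr (1 - r) - 1) * P < \<delta> / 2"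
    by (rule order_tendstoD) (use \<delta> in simp)
  moreover have "\<forall>\<^sub>F t in at_right (0::real). 0 < t \<and> t < 1"
    using eventually_at_right_real[of 0 1] by (auto elim: eventually_mono)
  ultimately have "\<forall>\<^sub>F t in at_right 0. ((1 - t) powr (1 - r) - 1) * P < \<delta> / 2 \<and> 0 < t \<and> t < 1"
    by (rule eventually_conj)
  from eventually_happens[OF this] obtain t
    where t: "0 < t" "t < 1" and tP: "((1 - t) powr (1 - r) - 1) * P < \<delta> / 2" by auto
  define L T where "L = (1 - t) powr (1 - r)" and "T = t powr (1 - r)"
  have T: "0 \<le> T" by (simp add: T_def)
  have L: "1 \<le> L" unfolding L_def using t r by (simp add: powr_minus_divide[of _ "r - 1", simplified] powr_le1)
  let ?\<mu> = "\<lambda>n z. min (fock_weighted m f z) (fock_weighted m (g n) z)"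
  define J where "J n = (\<integral>\<^sup>+ z. ennreal (?\<mu> n z powr r) \<partial>lborel)" for n
  have [measurable]: "f \<in> borel_measurable borel" "g n \<in> borel_measurable borel" for n
    using f g by (auto intro!: borel_measurable_entire fock_space_entire)
  have le: "ennreal (?\<mu> n z powr r) \<le> ennreal (fock_weighted m f z powr r)" for n z
    using r by (intro ennreal_leI powr_mono2) auto
  have fin: "(\<integral>\<^sup>+ z. ennreal (fock_weighted m f z powr r) \<partial>lborel) < \<infinity>"
    using fock_int_eq_norm_powr[OF r f] by (simp add: fock_int_eq)
  have "J \<longlonglongrightarrow> (\<integral>\<^sup>+ (z::complex). 0 \<partial>lborel)"
    unfolding J_def
  proof (rule nn_integral_dominated_convergence[of _ _ _ "\<lambda>z. ennreal (fock_weighted m f z powr r)"])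
    show "AE z in lborel. (\<lambda>n. ennreal (?\<mu> n z powr r)) \<longlonglongrightarrow> 0"
    proof (rule AE_I2)
      fix z
      have W0: "fock_weighted m (\<lambda>z. 0) z = 0" by (simp add: fock_weighted_def)
      have "(\<lambda>n. ?\<mu> n z powr r) \<longlonglongrightarrow> min (fock_weighted m f z) (fock_weighted m (\<lambda>z. 0) z) powr r"
        unfolding fock_weighted_def using r lim[of z] by (intro tendsto_intros tendsto_powr' ) auto
      then show "(\<lambda>n. ennreal (?\<mu> n z powr r)) \<longlonglongrightarrow> 0"
        by (intro tendsto_ennrealI[where x = 0, simplified]) (simp add: min_absorb2 W0)
    qed
  qed (use le fin in auto)
  then have J: "J \<longlonglongrightarrow> 0" by simp
  \<comment> \<open>The other half of \<delta> is left for the overlap, whose larger coefficient is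
    \<open>T + 1\<close>.\<close>
  define e where "e = \<delta> / 2 / (T + 1)"
  have e: "0 < e" using \<delta> T by (simp add: e_def)
  have "\<forall>\<^sub>F n in sequentially. J n < ennreal e"
    by (rule order_tendstoD(2)[OF J]) (use e in simp)
  then show ?thesis
  proof eventually_elim
    case (elim n)
    define I where "I = enn2real (J n)"
    have "J n < top" using elim ennreal_less_top less_trans by blast
    then have JI: "J n = ennreal I" "0 \<le> I" by (simp_all add: I_def)
    have "I < e" using elim e JI by (simp add: ennreal_less_iff)
    then have "(T + 1) * I \<le> (T + 1) * e" using T by (intro mult_left_mono) auto
    also have "\<dots> = \<delta> / 2" using T unfolding e_def
      by (subst times_divide_eq_right, intro nonzero_mult_div_cancel_left) simp
    finally have TI: "(T + 1) * I \<le> \<delta> / 2" .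
    have TI': "T * I \<le> (T + 1) * I" using JI by (intro mult_right_mono) auto
    define Y S where "Y = fock_norm m (ennreal r) (g n) powr r"
      and "S = fock_norm m (ennreal r) (\<lambda>z. f z + g n z) powr r"
    note bl = fock_norm_almost_additive[OF r t f g(1) JI(1)[unfolded J_def] JI(2),
        folded L_def T_def X_def Y_def S_def]
    have Y: "Y \<le> B powr r" unfolding Y_def using g(2) r by (intro powr_mono2) (auto simp: fock_norm_nonneg)
    have "fock_norm m (ennreal r) (\<lambda>z. f z + g n z) \<le> X + B"
      using fock_norm_add(2)[OF p f g(1)[of n]] g(2)[of n] by (simp add: X_def)
    then have S: "S \<le> (X + B) powr r" unfolding S_def using r by (intro powr_mono2) (auto simp: fock_norm_nonneg)
    have "(L - 1) * (X powr r + Y) \<le> (L - 1) * P" using L Y by (intro mult_left_mono) (auto simp: P_def intro: add_increasing2)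
    then have 1: "S - (X powr r + Y) \<le> \<delta>"
      using bl(1) tP TI TI' unfolding L_def[symmetric] by (simp add: algebra_simps)
    have "S \<le> P" using S unfolding P_def by (simp add: add_increasing)
    then have "(L - 1) * S \<le> (L - 1) * P" using L by (intro mult_left_mono) auto
    then have 2: "(X powr r + Y) - S \<le> \<delta>"
      using bl(2) tP TI unfolding L_def[symmetric] by (simp add: algebra_simps)
    show ?case using 1 2 unfolding S_def Y_def X_def by linarith
  qed
qed

section \<open>Decay at infinity, locally uniform null sequences and sparse selection\<close>

text \<open>The limit is that of the complex weighted function and not of its modulus, so finite
  sums are covered by additivity of limits.\<close>

definition fock_vanishing :: "real \<Rightarrow> (complex \<Rightarrow> complex) \<Rightarrow> bool" where
  "fock_vanishing m f \<longleftrightarrow> ((\<lambda>z. f z * of_real (exp (- (cmod z powr m)))) \<longlongrightarrow> 0) at_infinity"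

lemma fock_vanishing_sum:
  assumes "\<And>n. n \<in> A \<Longrightarrow> fock_vanishing m (h n)"
  shows "fock_vanishing m (\<lambda>z. \<Sum>n\<in>A. h n z)"
  unfolding fock_vanishing_def sum_distrib_right
  by (intro tendsto_null_sum assms[unfolded fock_vanishing_def])

text \<open>Brezis-Lieb uses only the pointwise consequence; the sup norm uses uniformity on
  discs.\<close>

definition loc_unif_null :: "(nat \<Rightarrow> complex \<Rightarrow> complex) \<Rightarrow> bool" where
  "loc_unif_null g \<longleftrightarrow>
     (\<forall>\<rho>. \<forall>e>0. \<forall>\<^sub>F n in sequentially. \<forall>z. cmod z \<le> \<rho> \<longrightarrow> cmod (g n z) \<le> e)"

lemma loc_unif_null_pointwise:
  assumes "loc_unif_null g"
  shows "(\<lambda>n. g n z) \<longlonglongrightarrow> 0"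
proof (rule tendstoI)
  fix e :: real assume "0 < e"
  then have "\<forall>\<^sub>F n in sequentially. \<forall>w. cmod w \<le> cmod z \<longrightarrow> cmod (g n w) \<le> e / 2"
    using assms half_gt_zero unfolding loc_unif_null_def by blast
  then show "\<forall>\<^sub>F n in sequentially. dist (g n z) 0 < e"
  proof eventually_elim
    case (elim n)
    then have "cmod (g n z) \<le> e / 2" by simp
    then show ?case using \<open>0 < e\<close> by simp
  qed
qed

text \<open>The counterpart of Brezis-Lieb for the sup norm. Outside a large disc the weighted
  \<open>f\<close> is below \<delta>, and inside it \<open>g n\<close> eventually is, so at every
  point one of the two summands contributes at most \<delta>.\<close>

lemma fock_norm_eventually_max:
  assumes f: "f \<in> fock_space m \<infinity>" "fock_vanishing m f"
    and g: "\<And>n. g n \<in> fock_space m \<infinity>" "loc_unif_null g" and \<delta>: "0 < \<delta>"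
  shows "\<forall>\<^sub>F n in sequentially. fock_norm m \<infinity> (\<lambda>z. f z + g n z)
      \<le> max (fock_norm m \<infinity> f) (fock_norm m \<infinity> (g n)) + \<delta>"
proof -
  have "\<forall>\<^sub>F z in at_infinity. dist (f z * of_real (exp (- (cmod z powr m)))) 0 < \<delta>"
    using f(2) \<delta> unfolding fock_vanishing_def by (rule tendstoD)
  then obtain R where R: "\<And>z. R \<le> cmod z \<Longrightarrow> fock_weighted m f z < \<delta>"
    unfolding eventually_at_infinity by (auto simp: fock_weighted_def norm_mult)
  have "\<forall>\<^sub>F n in sequentially. \<forall>z. cmod z \<le> R \<longrightarrow> cmod (g n z) \<le> \<delta>"
    using g(2) \<delta> unfolding loc_unif_null_def by blast
  then show ?thesis
  proof eventually_elim
    case (elim n)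
    have fg: "(\<lambda>z. f z + g n z) holomorphic_on UNIV"
      using fock_space_entire[OF f(1)] fock_space_entire[OF g(1)] by (intro holomorphic_intros)
    show ?case
    proof (rule fock_spaceI_sup(2)[OF fg])
      fix z
      show "fock_weighted m (\<lambda>z. f z + g n z) z \<le> max (fock_norm m \<infinity> f) (fock_norm m \<infinity> (g n)) + \<delta>"
      proof (cases "cmod z \<le> R")
        case True
        have "fock_weighted m (g n) z \<le> \<delta> * 1"
          unfolding fock_weighted_def using elim True \<delta> by (intro mult_mono) auto
        then show ?thesis
          using fock_weighted_triangle(1)[of m f "g n" z] fock_weighted_le_norm[OF f(1), of z] by linarith
      next
        case False
        then show ?thesis
          using fock_weighted_triangle(1)[of m f "g n" z] fock_weighted_le_norm[OF g(1), of n z] R[of z]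
          by linarith
      qed
    qed
  qed
qed

lemma unbounded_powr_contradiction:
  fixes \<theta> C :: real
  assumes "0 < \<theta>" "\<And>N::nat. 0 < N \<Longrightarrow> real N powr \<theta> \<le> C"
  shows False
proof -
  have C: "0 < C" using assms(2)[of 1] by simp
  obtain N where N: "(C + 1) powr (1 / \<theta>) \<le> real N" using real_arch_simple by blast
  moreover have "0 < (C + 1) powr (1 / \<theta>)" using C by simp
  ultimately have "0 < real N" by linarith
  then have "0 < N" by simp
  have "((C + 1) powr (1 / \<theta>)) powr \<theta> \<le> real N powr \<theta>" using N assms(1) by (intro powr_mono2) auto
  then have "C + 1 \<le> real N powr \<theta>" using assms(1) C by (simp add: powr_powr)
  with assms(2)[OF \<open>0 < N\<close>] show False by simp
qed

lemma fock_space_sum: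
  assumes p: "1 \<le> p" and m: "0 < m" and "finite A" and "\<And>n. n \<in> A \<Longrightarrow> g n \<in> fock_space m p"
  shows "(\<lambda>z. \<Sum>n\<in>A. g n z) \<in> fock_space m p"
  using assms(3,4)
proof (induction A rule: finite_induct)
  case (insert n A)
  then show ?case using fock_norm_add(1)[OF p, of "g n" m "\<lambda>z. \<Sum>n\<in>A. g n z"] by simp
qed (use fock_space_const[OF p m] in simp)

text \<open>Sums of \<open>N\<close> terms of a sparse subsequence of a bounded null sequence have \<open>s\<close>-norm at most
  of order \<open>N powr (1 / s)\<close>, and bounded norm for \<open>s = \<infinity>\<close>.\<close>
lemma fock_sparse_sum_upper:
  assumes s: "1 \<le> s"
    and h: "\<And>n. h n \<in> fock_space m s" "\<And>n. fock_norm m s (h n) \<le> B" "loc_unif_null h"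
    "\<And>n. fock_vanishing m (h n)"
  obtains U where "\<And>N x. U N x \<Longrightarrow> if s = \<infinity> then x \<le> B + 1 else x powr enn2real s \<le> real N * (B powr enn2real s + 1)"
    and "U 0 0"
    and "\<And>N f. f \<in> fock_space m s \<Longrightarrow> fock_vanishing m f \<Longrightarrow> U N (fock_norm m s f) \<Longrightarrow>
        \<forall>\<^sub>F n in sequentially. U (Suc N) (fock_norm m s (\<lambda>z. f z + h n z))"
  using s
proof (cases rule: exponent_cases)
  case 1
  have B: "0 \<le> B" by (rule order_trans[OF fock_norm_nonneg h(2)])
  show thesis
  \<comment> \<open>\<open>U\<close> is an induction invariant, left abstract so that finite and
    infinite exponents share one later induction. Here it is a strict inequality: every further term
    uses up part of the room below \<open>B + 1\<close>.\<close>
  proof (rule that[of "\<lambda>N x. x < B + 1"])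
    fix N :: nat and f
    assume f: "f \<in> fock_space m s" "fock_vanishing m f" and lt: "fock_norm m s f < B + 1"
    \<comment> \<open>Half of the remaining room, and at most 1/2 so that a single new term of norm
      at most \<open>B\<close> also stays below \<open>B + 1\<close>.\<close>
    define \<delta> where "\<delta> = min 1 (B + 1 - fock_norm m s f) / 2"
    have \<delta>: "0 < \<delta>" using lt by (simp add: \<delta>_def)
    have "\<forall>\<^sub>F n in sequentially. fock_norm m s (\<lambda>z. f z + h n z)
        \<le> max (fock_norm m s f) (fock_norm m s (h n)) + \<delta>"
      using fock_norm_eventually_max[OF f(1)[unfolded 1] f(2) h(1)[unfolded 1] h(3) \<delta>] by (simp add: 1)
    then show "\<forall>\<^sub>F n in sequentially. fock_norm m s (\<lambda>z. f z + h n z) < B + 1"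
    proof eventually_elim
      case (elim n)
      have "max (fock_norm m s f) (fock_norm m s (h n)) + \<delta> < B + 1"
      proof -
        have "\<delta> \<le> 1 / 2" by (simp add: \<delta>_def)
        then have "fock_norm m s (h n) + \<delta> < B + 1" using h(2)[of n] by linarith
        moreover have "\<delta> \<le> (B + 1 - fock_norm m s f) / 2" by (simp add: \<delta>_def)
        then have "fock_norm m s f + \<delta> < B + 1" using lt by argo
        ultimately show ?thesis by (simp add: max_def)
      qed
      with elim show ?case by simp
    qed
  qed (use 1 B in auto)
next
  case (2 r)
  have r: "1 \<le> r" by fact
  show thesis
  \<comment> \<open>A new term adds at most \<open>B powr r\<close> for its own norm and 1 for the
    error in Brezis-Lieb.\<close>
  proof (rule that[of "\<lambda>N x. x powr r \<le> real N * (B powr r + 1)"])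
    fix N :: nat and f
    assume f: "f \<in> fock_space m s" and le: "fock_norm m s f powr r \<le> real N * (B powr r + 1)"
    have "\<forall>\<^sub>F n in sequentially. \<bar>fock_norm m s (\<lambda>z. f z + h n z) powr r
      - (fock_norm m s f powr r + fock_norm m s (h n) powr r)\<bar> \<le> 1"
      unfolding 2(2) using f h(1,2) loc_unif_null_pointwise[OF h(3)]
      by (intro fock_norm_eventually_additive[where B = B] r) (simp_all add: 2(2))
    then show "\<forall>\<^sub>F n in sequentially. fock_norm m s (\<lambda>z. f z + h n z) powr r \<le> real (Suc N) * (B powr r + 1)"
    proof eventually_elim
      case (elim n)
      have "fock_norm m s (h n) powr r \<le> B powr r"
        using h(2) r by (intro powr_mono2) (auto simp: fock_norm_nonneg)
      then have "fock_norm m s (\<lambda>z. f z + h n z) powr r \<le> (B powr r + 1) + real N * (B powr r + 1)"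
        using elim le by linarith
      also have "\<dots> = real (Suc N) * (B powr r + 1)" by (simp add: distrib_right)
      finally show ?case .
    qed
  qed (use 2 in auto)
qed

text \<open>Indices are selected far enough out for both sequences at once, so the same finite set
  gives a large sum of the \<open>g n\<close> and a moderate sum of the \<open>h n\<close>. The
  assumed comparison on finite sums then bounds N^(1/r) by a multiple of N^(1/s), or by a constant
  if \<open>s = \<infinity>\<close>, although \<open>r < s\<close>.\<close>

lemma fock_sparse_sum_contradiction:
  assumes r: "1 \<le> r" and rs: "ennreal r < s" and m: "0 < m"
    and g: "\<And>n. g n \<in> fock_space m (ennreal r)" "\<And>n. fock_norm m (ennreal r) (g n) \<le> G"
    "\<And>n. c \<le> fock_norm m (ennreal r) (g n)" "0 < c" "loc_unif_null g"
    and h: "\<And>n. h n \<in> fock_space m s" "\<And>n. fock_norm m s (h n) \<le> B" "loc_unif_null h"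
    "\<And>n. fock_vanishing m (h n)"
    and K: "\<And>A. finite A \<Longrightarrow> fock_norm m (ennreal r) (\<lambda>z. \<Sum>n\<in>A. g n z) \<le> K * fock_norm m s (\<lambda>z. \<Sum>n\<in>A. h n z)"
  shows False
proof -
  have p: "1 \<le> ennreal r" using r by simp
  have s: "1 \<le> s" using p rs by (meson less_imp_le order_trans)
  \<comment> \<open>Each term contributes at least \<open>c powr r = 2 * a\<close>, of which one
    half pays for the Brezis-Lieb error.\<close>
  define a where "a = c powr r / 2"
  have a: "0 < a" using g(4) by (simp add: a_def)
  have B: "0 \<le> B" by (rule order_trans[OF fock_norm_nonneg h(2)])
  obtain U where U: "\<And>N x. U N x \<Longrightarrow> if s = \<infinity> then x \<le> B + 1 else x powr enn2real s \<le> real N * (B powr enn2real s + 1)"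
    and U0: "U 0 0"
    and U_step: "\<And>N f. f \<in> fock_space m s \<Longrightarrow> fock_vanishing m f \<Longrightarrow> U N (fock_norm m s f) \<Longrightarrow>
        \<forall>\<^sub>F n in sequentially. U (Suc N) (fock_norm m s (\<lambda>z. f z + h n z))"
    by (rule fock_sparse_sum_upper[OF s h]) blast
  \<comment> \<open>The next index is also kept outside \<open>A\<close>, so that the sum over the
    enlarged set is the old sum plus the new term.\<close>
  have sparse: "\<exists>A. finite A \<and> real N * a \<le> fock_norm m (ennreal r) (\<lambda>z. \<Sum>n\<in>A. g n z) powr r \<and>
      U N (fock_norm m s (\<lambda>z. \<Sum>n\<in>A. h n z))" for N
  proof (induction N)
    case 0
    show ?case by (rule exI[of _ "{}"]) (simp add: fock_norm_zero U0)
  next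
    case (Suc N)
    then obtain A where A: "finite A" "real N * a \<le> fock_norm m (ennreal r) (\<lambda>z. \<Sum>n\<in>A. g n z) powr r"
      "U N (fock_norm m s (\<lambda>z. \<Sum>n\<in>A. h n z))" by blast
    let ?G = "\<lambda>z. \<Sum>n\<in>A. g n z" and ?H = "\<lambda>z. \<Sum>n\<in>A. h n z"
    have "\<forall>\<^sub>F n in sequentially. U (Suc N) (fock_norm m s (\<lambda>z. ?H z + h n z))"
      using A h by (intro U_step fock_space_sum s m fock_vanishing_sum) auto
    moreover have "\<forall>\<^sub>F n in sequentially. \<bar>fock_norm m (ennreal r) (\<lambda>z. ?G z + g n z) powr r
      - (fock_norm m (ennreal r) ?G powr r + fock_norm m (ennreal r) (g n) powr r)\<bar> \<le> a"
      using A(1) g(1,2) loc_unif_null_pointwise[OF g(5)] a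
      by (intro fock_norm_eventually_additive[where B = G] r fock_space_sum p m) auto
    moreover have "\<forall>\<^sub>F n in sequentially. n \<notin> A"
    proof -
      have "\<forall>\<^sub>F n in sequentially. Max (insert 0 A) < n" by (rule eventually_gt_at_top)
      then show ?thesis
      proof eventually_elim
        case (elim n)
        then show ?case using Max_ge[of "insert 0 A" n] A(1) by fastforce
      qed
    qed
    ultimately have "\<forall>\<^sub>F n in sequentially. U (Suc N) (fock_norm m s (\<lambda>z. ?H z + h n z)) \<and>
      \<bar>fock_norm m (ennreal r) (\<lambda>z. ?G z + g n z) powr r
      - (fock_norm m (ennreal r) ?G powr r + fock_norm m (ennreal r) (g n) powr r)\<bar> \<le> a \<and> n \<notin> A"
      by eventually_elim blast
    then obtain n where n: "U (Suc N) (fock_norm m s (\<lambda>z. ?H z + h n z))"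
      "\<bar>fock_norm m (ennreal r) (\<lambda>z. ?G z + g n z) powr r
      - (fock_norm m (ennreal r) ?G powr r + fock_norm m (ennreal r) (g n) powr r)\<bar> \<le> a" "n \<notin> A"
      using eventually_happens[of _ sequentially] by (metis (lifting) trivial_limit_sequentially)
    have le: "c powr r \<le> fock_norm m (ennreal r) (g n) powr r"
      using g(3,4) r by (intro powr_mono2) auto
    have "real (Suc N) * a \<le> fock_norm m (ennreal r) (\<lambda>z. ?G z + g n z) powr r"
    proof -
      have "real (Suc N) * a = real N * a + a" "c powr r = 2 * a" by (simp_all add: a_def distrib_right)
      then show ?thesis using le abs_le_D2[OF n(2)] A(2) by linarith
    qed
    then show ?case
      using n(1,3) A(1) by (intro exI[of _ "insert n A"]) (simp add: add.commute)
  qed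
  have bound: "\<exists>x y. real N * a \<le> x powr r \<and> 0 \<le> x \<and> x \<le> K * y \<and> 0 \<le> y \<and>
      (if s = \<infinity> then y \<le> B + 1 else y powr enn2real s \<le> real N * (B powr enn2real s + 1))" for N
    using sparse[of N] U K fock_norm_nonneg by meson
  \<comment> \<open>\<open>K\<close> may be negative, whereas the comparison is about to be raised
    to the power \<open>r\<close>.\<close>
  define K1 where "K1 = \<bar>K\<bar>"
  have bound1: "\<exists>y. real N * a \<le> K1 powr r * y powr r \<and> 0 \<le> y \<and>
      (if s = \<infinity> then y \<le> B + 1 else y powr enn2real s \<le> real N * (B powr enn2real s + 1))" for N
  proof -
    obtain x y where xy: "real N * a \<le> x powr r" "0 \<le> x" "x \<le> K * y" "0 \<le> y"
      "if s = \<infinity> then y \<le> B + 1 else y powr enn2real s \<le> real N * (B powr enn2real s + 1)"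
      using bound[of N] by blast
    have "x \<le> K1 * y" using order_trans[OF xy(3) mult_right_mono[OF abs_ge_self xy(4)]] by (simp add: K1_def)
    then have "x powr r \<le> (K1 * y) powr r" using xy(2) r by (intro powr_mono2) auto
    also have "\<dots> = K1 powr r * y powr r" using xy(4) by (simp add: powr_mult K1_def)
    finally show ?thesis using xy by (intro exI[of _ y]) auto
  qed
  show False
    using s
  proof (cases rule: exponent_cases)
    case 1
    show False
    proof (rule unbounded_powr_contradiction[of 1 "K1 powr r * (B + 1) powr r / a"])
      fix N :: nat assume "0 < N"
      obtain y where y: "real N * a \<le> K1 powr r * y powr r" "0 \<le> y" "y \<le> B + 1"
        using bound1[of N] 1 by auto
      have "y powr r \<le> (B + 1) powr r" using y r by (intro powr_mono2) auto
      then have "real N * a \<le> K1 powr r * (B + 1) powr r"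
        using y(1) mult_left_mono[of "y powr r" "(B + 1) powr r" "K1 powr r"] by simp
      then show "real N powr 1 \<le> K1 powr r * (B + 1) powr r / a" using a \<open>0 < N\<close> by (simp add: field_simps)
    qed simp
  next
    case (2 t)
    have rt: "r < t" using rs 2 r by (simp add: ennreal_less_iff)
    define b where "b = B powr t + 1"
    have b: "0 < b" unfolding b_def by (simp add: add_nonneg_pos)
    show False
    \<comment> \<open>The comparison bounds \<open>N\<close> by a multiple of N^(r/t) with r/t <
      1.\<close>
    proof (rule unbounded_powr_contradiction[of "1 - r / t" "K1 powr r * b powr (r / t) / a"])
      fix N :: nat assume N: "0 < N"
      obtain y where y: "real N * a \<le> K1 powr r * y powr r" "0 \<le> y" "y powr t \<le> real N * b"
        using bound1[of N] 2 by (auto simp: b_def)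
      have "y powr r = (y powr t) powr (r / t)" using rt r by (simp add: powr_powr)
      also have "\<dots> \<le> (real N * b) powr (r / t)" using y(3) rt r by (intro powr_mono2) auto
      also have "\<dots> = real N powr (r / t) * b powr (r / t)" using b by (simp add: powr_mult)
      finally have "real N * a \<le> K1 powr r * (real N powr (r / t) * b powr (r / t))"
        using y(1) mult_left_mono[of "y powr r" _ "K1 powr r"] by (meson order_trans powr_ge_zero)
      then have "real N / real N powr (r / t) \<le> K1 powr r * b powr (r / t) / a"
        using a N by (simp add: field_simps)
      then show "real N powr (1 - r / t) \<le> K1 powr r * b powr (r / t) / a"
        using N by (simp add: powr_diff)
    qed (use rt r in simp)
  qed
qed

section \<open>Normalised monomials as test sequences\<close>

lemma filterlim_powr_at_top:
  assumes "0 < (m::real)"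
  shows "filterlim (\<lambda>x::real. x powr m) at_top at_top"
  unfolding filterlim_at_top_ge[where c = 1]
proof (intro allI impI)
  fix Z :: real assume Z: "1 \<le> Z"
  show "\<forall>\<^sub>F x in at_top. Z \<le> x powr m"
  proof (rule eventually_at_top_linorderI)
    fix x assume "Z powr (1 / m) \<le> x"
    then have "(Z powr (1 / m)) powr m \<le> x powr m" using assms by (intro powr_mono2) auto
    then show "Z \<le> x powr m" using assms Z by (simp add: powr_powr)
  qed
qed

lemma fock_vanishing_monomial:
  assumes m: "0 < m"
  shows "fock_vanishing m (\<lambda>z. c * z ^ n)"
proof -
  obtain A where A: "\<And>z. cmod (z ^ n) \<le> A * exp (cmod z powr m / 2)"
  proof (cases "n = 0")
    case True
    then show thesis using that[of 1] by simp
  next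
    case False
    then show thesis using that cmod_power_le_exp[OF m, of n] by blast
  qed
  have "((\<lambda>z::complex. exp (- (cmod z powr m / 2))) \<longlongrightarrow> 0) at_infinity"
  proof -
    have "filterlim (\<lambda>z::complex. cmod z powr m) at_top at_infinity"
      by (rule filterlim_compose[OF filterlim_powr_at_top[OF m] filterlim_norm_at_top])
    then have "filterlim (\<lambda>z::complex. 1 / 2 * cmod z powr m) at_top at_infinity"
      by (intro filterlim_tendsto_pos_mult_at_top[OF tendsto_const]) auto
    then have "filterlim (\<lambda>z::complex. - (cmod z powr m / 2)) at_bot at_infinity"
      by (simp add: filterlim_uminus_at_bot)
    then show ?thesis by (rule filterlim_compose[OF exp_at_bot])
  qed
  from tendsto_mult_left[OF this, of "cmod c * A"]
  have lim: "((\<lambda>z::complex. cmod c * A * exp (- (cmod z powr m / 2))) \<longlongrightarrow> 0) at_infinity" by simp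
  show ?thesis
    unfolding fock_vanishing_def
  proof (rule Lim_null_comparison[OF always_eventually[OF allI] lim])
    fix z
    have "norm (c * z ^ n * of_real (exp (- (cmod z powr m)))) = cmod c * (cmod (z ^ n) * exp (- (cmod z powr m)))"
      by (simp add: norm_mult mult.assoc)
    also have "\<dots> \<le> cmod c * ((A * exp (cmod z powr m / 2)) * exp (- (cmod z powr m)))"
      by (intro mult_left_mono mult_right_mono A) auto
    also have "\<dots> = cmod c * A * exp (- (cmod z powr m / 2))"
      by (simp add: mult.assoc flip: exp_add)
    finally show "norm (c * z ^ n * of_real (exp (- (cmod z powr m)))) \<le> cmod c * A * exp (- (cmod z powr m / 2))" .
  qed
qed

text \<open>The bound at radius \<open>2 * \<sigma>\<close> yields decay 2^(-n) on the disc of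
  radius \<sigma>, which beats the factor n + 1. That factor is present because the functions are
  the derivatives of \<open>b n * z ^ Suc n\<close>.\<close>

lemma loc_unif_null_monomials:
  fixes b :: "nat \<Rightarrow> complex"
  assumes b: "\<And>R n. 1 \<le> R \<Longrightarrow> R ^ n * cmod (b n) \<le> C R"
  shows "loc_unif_null (\<lambda>n z. of_nat (Suc n) * b n * z ^ n)"
  unfolding loc_unif_null_def
proof (intro allI impI)
  fix \<rho> e :: real assume e: "0 < e"
  define \<sigma> where "\<sigma> = max \<rho> 1"
  have \<sigma>: "1 \<le> \<sigma>" "\<rho> \<le> \<sigma>" by (auto simp: \<sigma>_def)
  have t1: "(\<lambda>n. real n * (1/2) ^ n) \<longlonglongrightarrow> 0" by (rule powser_times_n_limit_0) simp
  have t2: "(\<lambda>n. (1/2::real) ^ n) \<longlonglongrightarrow> 0" by (rule LIMSEQ_power_zero) simp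
  have "(\<lambda>n. C (2 * \<sigma>) * (real n * (1/2) ^ n + (1/2) ^ n)) \<longlonglongrightarrow> C (2 * \<sigma>) * (0 + 0)"
    by (intro tendsto_mult[OF tendsto_const] tendsto_add t1 t2)
  then have "\<forall>\<^sub>F n in sequentially. C (2 * \<sigma>) * (real n * (1/2) ^ n + (1/2) ^ n) < e"
    by (rule order_tendstoD) (use e in simp)
  then show "\<forall>\<^sub>F n in sequentially. \<forall>z. cmod z \<le> \<rho> \<longrightarrow> cmod (of_nat (Suc n) * b n * z ^ n) \<le> e"
  proof (eventually_elim, intro allI impI)
    fix n z
    assume lt: "C (2 * \<sigma>) * (real n * (1/2) ^ n + (1/2) ^ n) < e" and z: "cmod z \<le> \<rho>"
    have "cmod (of_nat (Suc n) * b n * z ^ n) = real (Suc n) * (cmod (b n) * cmod z ^ n)"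
      by (simp only: norm_mult norm_power norm_of_nat mult.assoc)
    also have "\<dots> \<le> real (Suc n) * (cmod (b n) * \<sigma> ^ n)"
      using z \<sigma> by (intro mult_left_mono power_mono) auto
    also have "\<dots> = real (Suc n) * (((2 * \<sigma>) ^ n * cmod (b n)) * (1/2) ^ n)"
      by (simp add: power_mult_distrib power_one_over)
    also have "\<dots> \<le> real (Suc n) * (C (2 * \<sigma>) * (1/2) ^ n)"
      using \<sigma> by (intro mult_left_mono mult_right_mono b) auto
    also have "\<dots> = C (2 * \<sigma>) * (real n * (1/2) ^ n + (1/2) ^ n)" by (simp add: algebra_simps)
    finally show "cmod (of_nat (Suc n) * b n * z ^ n) \<le> e" using lt by simp
  qed
qed

lemma exponents_eq_of_two_sided:
  assumes p: "1 \<le> p" and q: "1 \<le> q" and m: "0 < m" and D: "D_bounded m p q" and K: "0 < K"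
    and lower: "\<And>f. f \<in> fock_space m p \<Longrightarrow> f 0 = 0 \<Longrightarrow> fock_norm m p f \<le> K * fock_norm m q (deriv f)"
  shows "p = q"
proof (rule ccontr)
  assume "p \<noteq> q"
  obtain C0 where C0: "\<And>f. f \<in> fock_space m p \<Longrightarrow> fock_norm m q (deriv f) \<le> C0 * fock_norm m p f"
    using D by (auto simp: D_bounded_def)
  have Dq: "deriv f \<in> fock_space m q" if "f \<in> fock_space m p" for f
    using D that by (simp add: D_bounded_def)
  \<comment> \<open>Degrees start at 1, so that the normalised monomials vanish at 0 and the lower
    bound applies to them and to their sums.\<close>
  define a where "a n = fock_norm m p (\<lambda>z. z ^ Suc n)" for n :: nat
  have a: "0 < a n" for n unfolding a_def by (rule monomial_norm_pos[OF p m])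
  define u where "u n z = complex_of_real (1 / a n) * z ^ Suc n" for n z
  define v where "v n = deriv (u n)" for n
  have u_mem: "u n \<in> fock_space m p" and u_norm: "fock_norm m p (u n) = 1" for n
    using fock_norm_cmult[OF p monomial_in_fock_space[OF p m, of "Suc n"], of "complex_of_real (1 / a n)"] a[of n]
    by (simp_all only: u_def[abs_def] a_def[symmetric]) (simp_all add: norm_divide)
  have v: "v n z = of_nat (Suc n) * complex_of_real (1 / a n) * z ^ n" for n z
    using deriv_add_cmult_entire[of "\<lambda>z. 0" "\<lambda>z. z ^ Suc n" "complex_of_real (1 / a n)"]
    unfolding v_def u_def[abs_def] deriv_monomial
    by (simp add: holomorphic_on_power holomorphic_on_ident holomorphic_on_mult del: of_nat_Suc)
  have v_mem: "v n \<in> fock_space m q" for n unfolding v_def by (rule Dq[OF u_mem])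
  have v_upper: "fock_norm m q (v n) \<le> C0" for n using C0[OF u_mem[of n]] by (simp add: v_def u_norm)
  have v_lower: "1 / K \<le> fock_norm m q (v n)" for n
    using lower[OF u_mem[of n]] K by (simp add: v_def u_norm field_simps) (simp add: u_def)
  \<comment> \<open>The point evaluation at an arbitrary radius \<open>R\<close> shows that the
    normalising factors decay faster than every geometric sequence.\<close>
  have small: "R ^ n * cmod (complex_of_real (1 / a n)) \<le> 2 * exp ((R + 1) powr m)" if R: "1 \<le> R" for R n
  proof -
    have "R ^ n \<le> R ^ Suc n" using R by (intro power_increasing) auto
    also have "\<dots> \<le> 2 * exp ((R + 1) powr m) * a n"
      unfolding a_def using R by (intro power_le_monomial_norm p m) auto
    finally show ?thesis using a[of n] by (simp add: norm_divide field_simps)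
  qed
  have v_null: "loc_unif_null v"
    using loc_unif_null_monomials[of "\<lambda>n. complex_of_real (1 / a n)" "\<lambda>R. 2 * exp ((R + 1) powr m)", OF small]
    by (simp only: v[abs_def])
  \<comment> \<open>Inherited from the derivatives: the modulus of \<open>u n z\<close> is that of
    \<open>v n z\<close> times |z| / (n + 1). The factor \<open>\<bar>\<rho>\<bar> + 1\<close> is
    positive also for radii that are not.\<close>
  have u_null: "loc_unif_null u"
    unfolding loc_unif_null_def
  proof (intro allI impI)
    fix \<rho> e :: real assume e: "0 < e"
    define e' where "e' = e / (\<bar>\<rho>\<bar> + 1)"
    have e': "0 < e'" using e by (simp add: e'_def add_nonneg_pos)
    have "\<forall>\<^sub>F n in sequentially. \<forall>z. cmod z \<le> \<rho> \<longrightarrow> cmod (v n z) \<le> e'"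
      using v_null e' unfolding loc_unif_null_def by blast
    then show "\<forall>\<^sub>F n in sequentially. \<forall>z. cmod z \<le> \<rho> \<longrightarrow> cmod (u n z) \<le> e"
    proof (eventually_elim, intro allI impI)
      fix n z assume le: "\<forall>z. cmod z \<le> \<rho> \<longrightarrow> cmod (v n z) \<le> e'" and z: "cmod z \<le> \<rho>"
      have "cmod (u n z) = cmod z * (1 * (cmod (complex_of_real (1 / a n)) * cmod z ^ n))"
        by (simp only: u_def norm_mult norm_power power_Suc mult.left_commute mult_1)
      also have "\<dots> \<le> cmod z * (real (Suc n) * (cmod (complex_of_real (1 / a n)) * cmod z ^ n))"
        by (intro mult_left_mono mult_right_mono) auto
      also have "\<dots> = cmod z * cmod (v n z)"
        by (simp only: v norm_mult norm_power norm_of_nat mult.assoc)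
      also have "\<dots> \<le> (\<bar>\<rho>\<bar> + 1) * e'" using le z by (intro mult_mono) auto
      also have "\<dots> = e" unfolding e'_def
        by (subst times_divide_eq_right, intro nonzero_mult_div_cancel_left) simp
      finally show "cmod (u n z) \<le> e" .
    qed
  qed
  have u_van: "fock_vanishing m (u n)" for n unfolding u_def by (rule fock_vanishing_monomial[OF m])
  have v_van: "fock_vanishing m (v n)" for n unfolding v[abs_def] by (rule fock_vanishing_monomial[OF m])
  have sum_mem: "(\<lambda>z. \<Sum>n\<in>A. u n z) \<in> fock_space m p" if "finite A" for A
    by (intro fock_space_sum p m that u_mem)
  have sum_deriv: "deriv (\<lambda>z. \<Sum>n\<in>A. u n z) = (\<lambda>z. \<Sum>n\<in>A. v n z)" for A
    unfolding v_def
    by (rule ext, rule DERIV_imp_deriv) (intro DERIV_sum has_field_derivative_entire fock_space_entire[OF u_mem])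
  have sum_lower: "fock_norm m p (\<lambda>z. \<Sum>n\<in>A. u n z) \<le> K * fock_norm m q (\<lambda>z. \<Sum>n\<in>A. v n z)" if "finite A" for A
    using lower[OF sum_mem[OF that]] unfolding sum_deriv by (simp add: u_def)
  have sum_upper: "fock_norm m q (\<lambda>z. \<Sum>n\<in>A. v n z) \<le> C0 * fock_norm m p (\<lambda>z. \<Sum>n\<in>A. u n z)" if "finite A" for A
    using C0[OF sum_mem[OF that]] unfolding sum_deriv .
  show False
  \<comment> \<open>The sequence measured in the smaller, hence finite, exponent needs norms bounded
    away from 0. For \<open>u\<close> this is the normalisation, for \<open>v\<close> it is the
    bound \<open>1 / K\<close>.\<close>
  proof (cases "p < q")
    case True
    then obtain r where r: "1 \<le> r" "p = ennreal r" using exponent_cases[OF p] by (metis infinity_ennreal_def not_top_less)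
    show False
      by (rule fock_sparse_sum_contradiction[OF r(1) True[unfolded r(2)] m, of u 1 1 v C0 K])
        (use u_mem u_norm u_null v_mem v_upper v_null v_van sum_lower in \<open>simp_all add: r(2)\<close>)
  next
    case False
    with \<open>p \<noteq> q\<close> have lt: "q < p" by simp
    then obtain r where r: "1 \<le> r" "q = ennreal r" using exponent_cases[OF q] by (metis infinity_ennreal_def not_top_less)
    show False
      by (rule fock_sparse_sum_contradiction[OF r(1) lt[unfolded r(2)] m, of v C0 "1 / K" u 1 C0])
        (use u_mem u_norm u_null v_mem v_upper v_lower v_null u_van sum_upper K in \<open>simp_all add: r(2)\<close>)
  qed
qed

section \<open>Primitives for m = 1\<close>

lemma nn_integral_lborel_complex_scale:
  assumes [measurable]: "\<phi> \<in> borel_measurable borel" and t: "0 < t"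
  shows "(\<integral>\<^sup>+ z. \<phi> (of_real t * z) \<partial>lborel) = ennreal (1 / t\<^sup>2) * (\<integral>\<^sup>+ (z::complex). \<phi> z \<partial>lborel)"
proof -
  have "(\<integral>\<^sup>+ z. \<phi> z \<partial>lborel) = ennreal (t\<^sup>2) * (\<integral>\<^sup>+ z. \<phi> (of_real t * z) \<partial>lborel)"
    by (subst lborel_affine[of t "0::complex"])
      (use t in \<open>simp_all add: nn_integral_density nn_integral_distr nn_integral_cmult scaleR_conv_of_real\<close>)
  then have "ennreal (1 / t\<^sup>2) * (\<integral>\<^sup>+ z. \<phi> z \<partial>lborel)
      = (ennreal (1 / t\<^sup>2) * ennreal (t\<^sup>2)) * (\<integral>\<^sup>+ z. \<phi> (of_real t * z) \<partial>lborel)"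
    by (simp only: mult.assoc)
  also have "ennreal (1 / t\<^sup>2) * ennreal (t\<^sup>2) = 1"
    using t by (simp flip: ennreal_mult)
  finally show ?thesis by simp
qed

text \<open>With \<open>s = 1 / t\<close> the integral is \<open>\<integral>\<^sub>1\<^sup>\<infinity> \<rho> s exp (- \<rho> (s - 1)) ds\<close>.\<close>
lemma scaling_kernel_bound:
  fixes \<rho> :: real
  assumes \<rho>: "0 \<le> \<rho>"
  shows "(\<integral>\<^sup>+ t. ennreal (\<rho> / t ^ 3 * exp (- \<rho> * (1 / t - 1))) * indicator {0<..1} t \<partial>lborel)
    \<le> ennreal (1 + 1 / \<rho>)"
proof (cases "\<rho> = 0")
  case False
  with \<rho> have pos: "0 < \<rho>" by simp
  define k where "k t = \<rho> / t ^ 3 * exp (- \<rho> * (1 / t - 1))" for t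
  \<comment> \<open>A primitive of \<open>k\<close>, found by integrating by parts in the variable 1
    / t; \<open>H 1 = 1 + 1 / \<rho>\<close> is the asserted bound.\<close>
  define H where "H t = (1 / t + 1 / \<rho>) * exp (- \<rho> * (1 / t - 1))" for t
  have [measurable]: "k \<in> borel_measurable borel" unfolding k_def[abs_def] by measurable
  have deriv: "(H has_real_derivative k t) (at t)" if "0 < t" for t
  proof -
    have "(H has_real_derivative (- 1 / t\<^sup>2) * exp (- \<rho> * (1 / t - 1))
        + (1 / t + 1 / \<rho>) * (exp (- \<rho> * (1 / t - 1)) * (\<rho> / t\<^sup>2))) (at t)"
      unfolding H_def[abs_def] using that pos
      by (auto intro!: derivative_eq_intros simp: power2_eq_square field_simps)
    also have "(- 1 / t\<^sup>2) * exp (- \<rho> * (1 / t - 1))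
        + (1 / t + 1 / \<rho>) * (exp (- \<rho> * (1 / t - 1)) * (\<rho> / t\<^sup>2)) = k t"
    proof -
      have e1: "(- 1 / t\<^sup>2) + (1 / t + 1 / \<rho>) * (\<rho> / t\<^sup>2) = \<rho> / t ^ 3"
        using that pos by (simp add: field_simps power2_eq_square power3_eq_cube)
      have e2: "a * e + b * (e * c) = (a + b * c) * e" for a b c e :: real
        by (simp add: distrib_right)
      show ?thesis unfolding k_def by (simp only: e2 e1)
    qed
    finally show ?thesis .
  qed
  \<comment> \<open>The left endpoint is kept away from 0, where \<open>H\<close> is singular. The
    value of \<open>H\<close> there is nonnegative and is dropped, and Fatou removes the
    truncation.\<close>
  have part: "(\<integral>\<^sup>+ t. ennreal (k t) * indicator {1 / real (Suc n)..1} t \<partial>lborel) \<le> ennreal (1 + 1 / \<rho>)" for n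
  proof -
    have "(\<integral>\<^sup>+ t. ennreal (k t) * indicator {1 / real (Suc n)..1} t \<partial>lborel) = H 1 - H (1 / real (Suc n))"
    proof (rule nn_integral_FTC_Icc)
      fix t assume "t \<in> {1 / real (Suc n)..1}"
      then have "1 / real (Suc n) \<le> t" by simp
      then have t: "0 < t" by (meson less_le_trans of_nat_0_less_iff zero_less_Suc zero_less_divide_1_iff)
      show "(H has_real_derivative k t) (at t)" by (rule deriv[OF t])
      show "0 \<le> k t" using t pos by (simp add: k_def)
    qed (auto simp: field_simps)
    also have "\<dots> \<le> ennreal (1 + 1 / \<rho>)" using pos by (intro ennreal_leI) (simp add: H_def add_nonneg_nonneg)
    finally show ?thesis .
  qed
  have lim: "(\<lambda>n. ennreal (k t) * indicator {1 / real (Suc n)..1} t) \<longlonglongrightarrow> ennreal (k t) * indicator {0<..1} t" for t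
  proof (rule tendsto_eventually)
    show "\<forall>\<^sub>F n in sequentially. ennreal (k t) * indicator {1 / real (Suc n)..1} t = ennreal (k t) * indicator {0<..1} t"
    proof (cases "0 < t")
      case True
      have "\<forall>\<^sub>F n in sequentially. inverse (real (Suc n)) < t" by (rule Archimedean_eventually_inverse[THEN iffD2, OF True])
      then show ?thesis by eventually_elim (use True in \<open>auto simp: indicator_def inverse_eq_divide\<close>)
    next
      case False
      have "\<not> 1 / real (Suc n) \<le> t" for n
        using False by (meson less_le_trans of_nat_0_less_iff zero_less_Suc zero_less_divide_1_iff)
      then show ?thesis using False by (simp add: indicator_def)
    qed
  qed
  have "(\<integral>\<^sup>+ t. ennreal (k t) * indicator {0<..1} t \<partial>lborel)
      = (\<integral>\<^sup>+ t. liminf (\<lambda>n. ennreal (k t) * indicator {1 / real (Suc n)..1} t) \<partial>lborel)"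
    by (intro nn_integral_cong) (use lim_imp_Liminf[OF _ lim] in auto)
  also have "\<dots> \<le> liminf (\<lambda>n. \<integral>\<^sup>+ t. ennreal (k t) * indicator {1 / real (Suc n)..1} t \<partial>lborel)"
    by (intro nn_integral_liminf) simp
  also have "\<dots> \<le> liminf (\<lambda>n. ennreal (1 + 1 / \<rho>))"
    by (intro Liminf_mono always_eventually allI part)
  finally show ?thesis by (simp add: k_def Liminf_const)
qed simp

text \<open>With \<rho> = |z| this is |z| times the quotient of the weights exp(-|z|) at
  \<open>z\<close> and exp(-t|z|) at \<open>t z\<close>, for \<open>m = 1\<close>. Its integral over
  [0,1] is 1 - exp(-\<rho>), so the primitive is controlled by a subprobability average of the
  weighted \<open>g\<close> on the segment from 0 to \<open>z\<close>.\<close>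

definition radial_kernel :: "real \<Rightarrow> real \<Rightarrow> real" where
  "radial_kernel \<rho> t = \<rho> * exp (- (\<rho> * (1 - t)))"

lemma radial_kernel_nonneg: "0 \<le> \<rho> \<Longrightarrow> 0 \<le> radial_kernel \<rho> t"
  by (simp add: radial_kernel_def)

lemma nn_integral_radial_kernel_le_1:
  assumes "0 \<le> \<rho>"
  shows "(\<integral>\<^sup>+ t. ennreal (radial_kernel \<rho> t) * indicator {0..1} t \<partial>lborel) \<le> 1"
proof -
  have "(\<integral>\<^sup>+ t. ennreal (radial_kernel \<rho> t) * indicator {0..1} t \<partial>lborel)
      = ennreal (exp (- (\<rho> * (1 - 1))) - exp (- (\<rho> * (1 - 0))))"
  proof (rule nn_integral_FTC_Icc)
    show "((\<lambda>t. exp (- (\<rho> * (1 - t)))) has_real_derivative radial_kernel \<rho> t) (at t)" for t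
      unfolding radial_kernel_def by (auto intro!: derivative_eq_intros)
  qed (use assms in \<open>auto simp: radial_kernel_def[abs_def]\<close>)
  also have "\<dots> \<le> ennreal 1" by (intro ennreal_leI) simp
  finally show ?thesis by simp
qed

text \<open>The derivative \<open>g\<close> is integrated along the segment from 0 to
  \<open>z\<close>, and exp(-|z|) is split into the weight at \<open>t z\<close> and the exponential
  factor of the kernel.\<close>

lemma fock_weighted_primitive_le:
  assumes f: "\<And>z. (f has_field_derivative g z) (at z)" and f0: "f 0 = 0" and g: "g holomorphic_on UNIV"
  shows "ennreal (fock_weighted 1 f z)
    \<le> (\<integral>\<^sup>+ t. ennreal (fock_weighted 1 g (of_real t * z) * radial_kernel (cmod z) t) * indicator {0..1} t \<partial>lborel)"
proof -
  let ?k = "\<lambda>t. fock_weighted 1 g (of_real t * z) * radial_kernel (cmod z) t"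
  have "((\<lambda>t. f (of_real t * z)) has_vector_derivative g (of_real t * z) * z) (at t within {0..1})" for t
  proof -
    have "((\<lambda>w. f (w * z)) has_field_derivative g (of_real t * z) * z) (at (of_real t))"
      by (rule DERIV_chain2[OF f]) (auto intro!: derivative_eq_intros)
    then show ?thesis by (rule has_vector_derivative_real_field[THEN has_vector_derivative_at_within])
  qed
  then have I: "((\<lambda>t. g (of_real t * z) * z) has_integral f (of_real 1 * z) - f (of_real 0 * z)) {0..1}"
    by (intro fundamental_theorem_of_calculus) auto
  have "continuous_on {0..1} (\<lambda>t. g (of_real t * z) * z)"
    by (intro continuous_intros continuous_on_compose2[OF holomorphic_on_imp_continuous_on[OF g]]) auto
  then have "continuous_on {0..1} (\<lambda>t. cmod (g (of_real t * z) * z) * exp (- cmod z))"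
    by (rule continuous_on_mult[OF continuous_on_norm continuous_on_const])
  then have int: "(\<lambda>t. cmod (g (of_real t * z) * z) * exp (- cmod z)) integrable_on {0..1}"
    by (rule integrable_continuous_real)
  have "cmod (f z) * exp (- cmod z) = cmod (integral {0..1} (\<lambda>t. g (of_real t * z) * z * of_real (exp (- cmod z))))"
    using integral_unique[OF has_integral_mult_left[OF I, of "of_real (exp (- cmod z))"]] f0 by (simp add: norm_mult)
  also have "\<dots> \<le> integral {0..1} (\<lambda>t. cmod (g (of_real t * z) * z) * exp (- cmod z))"
    by (rule integral_norm_bound_integral[OF has_integral_integrable[OF has_integral_mult_left[OF I]] int])
      (simp add: norm_mult)
  finally have "ennreal (fock_weighted 1 f z)
      \<le> ennreal (integral {0..1} (\<lambda>t. cmod (g (of_real t * z) * z) * exp (- cmod z)))"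
    by (intro ennreal_leI) (simp add: fock_weighted_def)
  also have "\<dots> = (\<integral>\<^sup>+ t. ennreal (cmod (g (of_real t * z) * z) * exp (- cmod z)) * indicator {0..1} t \<partial>lborel)"
    by (rule nn_integral_has_integral_lebesgue'[OF _ integrable_integral[OF int], symmetric]) auto
  also have "\<dots> = (\<integral>\<^sup>+ t. ennreal (?k t) * indicator {0..1} t \<partial>lborel)"
  proof (intro nn_integral_cong)
    fix t :: real
    have "cmod (g (of_real t * z) * z) * exp (- cmod z) = ?k t" if "0 \<le> t"
    proof -
      have "- cmod z = - (t * cmod z) + - (cmod z * (1 - t))" by (simp add: algebra_simps)
      then have "exp (- cmod z) = exp (- (t * cmod z)) * exp (- (cmod z * (1 - t)))" by (metis exp_add)
      then show ?thesis using that by (simp add: fock_weighted_def radial_kernel_def norm_mult mult_ac)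
    qed
    then show "ennreal (cmod (g (of_real t * z) * z) * exp (- cmod z)) * indicator {0..1} t = ennreal (?k t) * indicator {0..1} t"
      by (auto split: split_indicator)
  qed
  finally show ?thesis .
qed

text \<open>\<open>le_add_powr\<close> is applied with half of the quantity to be bounded. As the
  kernel has mass at most 1, the linear term costs at most that half and can be cancelled from the
  left side; the division by 2 is the loss compared with Jensen.\<close>

lemma fock_weighted_primitive_powr_le:
  assumes r: "1 \<le> r"
    and f: "\<And>z. (f has_field_derivative g z) (at z)" and f0: "f 0 = 0" and g: "g holomorphic_on UNIV"
  shows "ennreal ((fock_weighted 1 f z / 2) powr r)
    \<le> (\<integral>\<^sup>+ t. ennreal (fock_weighted 1 g (of_real t * z) powr r * radial_kernel (cmod z) t) * indicator {0..1} t \<partial>lborel)"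
    (is "_ \<le> ?J")
proof (cases "fock_weighted 1 f z = 0")
  case False
  define L where "L = fock_weighted 1 f z / 2"
  have L: "0 < L" using False fock_weighted_nonneg[of 1 f z] by (simp add: L_def less_le)
  define c where "c = L powr (1 - r)"
  have c: "0 \<le> c" by (simp add: c_def)
  have [measurable]: "g \<in> borel_measurable borel" by (rule borel_measurable_entire[OF g])
  have [measurable]: "radial_kernel \<rho> \<in> borel_measurable borel" for \<rho>
    unfolding radial_kernel_def[abs_def] by measurable
  let ?G = "\<lambda>t. fock_weighted 1 g (of_real t * z)" and ?k = "radial_kernel (cmod z)"
  have "ennreal (2 * L) \<le> (\<integral>\<^sup>+ t. ennreal (?G t * ?k t) * indicator {0..1} t \<partial>lborel)"
    using fock_weighted_primitive_le[OF f f0 g, of z] by (simp add: L_def)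
  also have "\<dots> \<le> (\<integral>\<^sup>+ t. ennreal L * (ennreal (?k t) * indicator {0..1} t)
      + ennreal c * (ennreal (?G t powr r * ?k t) * indicator {0..1} t) \<partial>lborel)"
  proof (rule nn_integral_mono)
    fix t
    have k: "0 \<le> ?k t" by (simp add: radial_kernel_nonneg)
    have "?G t * ?k t \<le> (L + c * ?G t powr r) * ?k t"
      unfolding c_def by (intro mult_right_mono le_add_powr L r k) simp
    then have "ennreal (?G t * ?k t) \<le> ennreal (L * ?k t + c * (?G t powr r * ?k t))"
      by (intro ennreal_leI) (simp add: algebra_simps)
    also have "\<dots> = ennreal L * ennreal (?k t) + ennreal c * ennreal (?G t powr r * ?k t)"
      using L c k by (simp add: ennreal_mult)
    finally show "ennreal (?G t * ?k t) * indicator {0..1} t \<le> ennreal L * (ennreal (?k t) * indicator {0..1} t)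
      + ennreal c * (ennreal (?G t powr r * ?k t) * indicator {0..1} t)"
      by (auto split: split_indicator)
  qed
  also have "\<dots> = ennreal L * (\<integral>\<^sup>+ t. ennreal (?k t) * indicator {0..1} t \<partial>lborel) + ennreal c * ?J"
    by (simp add: nn_integral_add nn_integral_cmult)
  also have "\<dots> \<le> ennreal L * 1 + ennreal c * ?J"
    by (intro add_mono mult_left_mono nn_integral_radial_kernel_le_1) auto
  finally have "ennreal L + ennreal L \<le> ennreal L + ennreal c * ?J"
    using L by (simp flip: ennreal_plus)
  then have "ennreal L \<le> ennreal c * ?J" by (simp add: ennreal_add_left_cancel_le)
  then have "ennreal (L powr (r - 1)) * ennreal L \<le> ennreal (L powr (r - 1)) * (ennreal c * ?J)"
    by (rule mult_left_mono) simp
  also have "\<dots> = ennreal (L powr (r - 1) * c) * ?J" by (simp add: ennreal_mult' mult.assoc c)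
  also have "L powr (r - 1) * c = 1" using L by (simp add: c_def flip: powr_add)
  also have "ennreal (L powr (r - 1)) * ennreal L = ennreal (L powr r)"
    using L powr_mult_base[of L "r - 1"] by (simp add: mult.commute flip: ennreal_mult)
  finally show ?thesis by (simp add: L_def)
qed (use r in simp)

text \<open>After Tonelli and the substitution w = t z the kernel has mass at most 1 + 1/|w| as a
  function of \<open>w\<close>. This is at most 2 off the unit disc; inside it,
  \<open>g 0 = 0\<close> makes the weighted \<open>g\<close> at most a multiple of |w|, and as r
  \<ge> 1 its r-th power absorbs the singularity.\<close>

lemma primitive_in_fock_space_finite:
  assumes r: "1 \<le> r" and g: "g \<in> fock_space 1 (ennreal r)" and g0: "g 0 = 0"
    and f: "\<And>z. (f has_field_derivative g z) (at z)" and f0: "f 0 = 0"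
  shows "f \<in> fock_space 1 (ennreal r)"
proof -
  note hol = fock_space_entire[OF g]
  have f_hol: "f holomorphic_on UNIV" unfolding holomorphic_on_open[OF open_UNIV] using f by auto
  have [measurable]: "g \<in> borel_measurable borel" "f \<in> borel_measurable borel"
    using hol f_hol by (auto intro: borel_measurable_entire)
  have [measurable]: "(\<lambda>x. radial_kernel (cmod (fst x)) (snd x)) \<in> borel_measurable (borel \<Otimes>\<^sub>M borel)"
    unfolding radial_kernel_def by measurable
  have [measurable]: "Measurable.pred borel (\<lambda>w::complex. w \<in> ball 0 1)" by simp
  have [measurable]: "(\<lambda>z::complex. radial_kernel (cmod z) t) \<in> borel_measurable borel" for t
    unfolding radial_kernel_def by measurable
  let ?G = "\<lambda>z. fock_weighted 1 g z powr r"
  \<comment> \<open>A bound for the derivative of \<open>g\<close> on the closed unit disc.\<close>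
  obtain C where C: "0 \<le> C" "\<And>w. cmod w < 1 \<Longrightarrow> cmod (g w) \<le> C * cmod w"
  proof -
    have "continuous_on (cball 0 1) (deriv g)"
      by (rule holomorphic_on_imp_continuous_on[OF holomorphic_on_subset[OF holomorphic_deriv[OF hol open_UNIV]]]) simp
    then have "bounded (deriv g ` cball 0 1)" by (intro compact_imp_bounded compact_continuous_image) auto
    then obtain C where C: "\<And>w. w \<in> cball 0 1 \<Longrightarrow> cmod (deriv g w) \<le> C" unfolding bounded_iff by (auto simp del: mem_cball mem_cball_0)
    show thesis
    proof (rule that[of C])
      show "0 \<le> C" using order_trans[OF norm_ge_zero C[of 0]] by simp
      fix w :: complex assume "cmod w < 1"
      then have "norm (g w - g 0) \<le> C * norm (w - 0)"
        by (intro field_differentiable_bound[of "cball 0 1" g "deriv g"] C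
            has_field_derivative_at_within[OF has_field_derivative_entire[OF hol]]) auto
      then show "cmod (g w) \<le> C * cmod w" using g0 by simp
    qed
  qed
  \<comment> \<open>At \<open>w = 0\<close> the convention \<open>1 / 0 = 0\<close> puts the point
    among the harmless ones.\<close>
  have near: "?G w * (1 + 1 / cmod w) \<le> 2 * ?G w + C powr r * indicator (ball 0 1) w" for w
  proof (cases "cmod w < 1 \<and> w \<noteq> 0")
    case True
    then have w: "0 < cmod w" "cmod w < 1" by auto
    have "fock_weighted 1 g w \<le> C * cmod w * 1"
      unfolding fock_weighted_def using C(2)[OF w(2)] C(1) by (intro mult_mono) auto
    then have "?G w \<le> (C * cmod w) powr r" using r by (intro powr_mono2) auto
    also have "\<dots> = C powr r * cmod w powr r" using C(1) by (simp add: powr_mult)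
    also have "\<dots> \<le> C powr r * cmod w"
      using w r powr_mono'[of 1 r "cmod w"] by (intro mult_left_mono) auto
    finally have "?G w / cmod w \<le> C powr r" using w by (simp add: divide_le_eq)
    moreover have "0 \<le> ?G w" by simp
    ultimately show ?thesis using w by (simp add: distrib_left add_increasing)
  next
    case False
    then have "1 / cmod w \<le> 1" by (cases "w = 0") (auto simp: divide_le_eq)
    then have "?G w * (1 + 1 / cmod w) \<le> ?G w * 2" by (intro mult_left_mono) auto
    then show ?thesis by (simp add: add_increasing2 mult.commute)
  qed
  \<comment> \<open>The Jacobian of w = t z in real dimension 2 gives 1 / t^2, and |z| = |w| / t in
    the kernel gives the third power.\<close>
  have inner: "(\<integral>\<^sup>+ z. ennreal (?G (of_real t * z) * radial_kernel (cmod z) t) \<partial>lborel) * indicator {0<..1} t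
      = (\<integral>\<^sup>+ w. ennreal (?G w) * (ennreal (cmod w / t ^ 3 * exp (- cmod w * (1 / t - 1))) * indicator {0<..1} t) \<partial>lborel)" for t
  proof (cases "t \<in> {0<..1}")
    case True
    then have t: "0 < t" by simp
    let ?\<phi> = "\<lambda>w. ennreal (?G w * (cmod w / t * exp (- cmod w * (1 / t - 1))))"
    have "(\<integral>\<^sup>+ z. ennreal (?G (of_real t * z) * radial_kernel (cmod z) t) \<partial>lborel) = (\<integral>\<^sup>+ z. ?\<phi> (of_real t * z) \<partial>lborel)"
    proof (intro nn_integral_cong arg_cong[where f = ennreal] arg_cong2[where f = "(*)"] refl)
      fix z
      have eq': "cmod (of_real t * z) / t = cmod z" using t by (simp add: norm_mult)
      have eq: "- cmod (of_real t * z) * (1 / t - 1) = - (cmod z * (1 - t))"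
        using t by (simp add: norm_mult field_simps)
      show "radial_kernel (cmod z) t = cmod (of_real t * z) / t * exp (- cmod (of_real t * z) * (1 / t - 1))"
        by (simp only: eq eq' radial_kernel_def)
    qed
    also have "\<dots> = ennreal (1 / t\<^sup>2) * (\<integral>\<^sup>+ w. ?\<phi> w \<partial>lborel)"
      by (rule nn_integral_lborel_complex_scale) (use t in auto)
    also have "\<dots> = (\<integral>\<^sup>+ w. ennreal (1 / t\<^sup>2) * ?\<phi> w \<partial>lborel)" by (rule nn_integral_cmult[symmetric]) simp
    also have "\<dots> = (\<integral>\<^sup>+ w. ennreal (?G w) * ennreal (cmod w / t ^ 3 * exp (- cmod w * (1 / t - 1))) \<partial>lborel)"
      using t by (intro nn_integral_cong)
        (simp add: power2_eq_square power3_eq_cube mult_ac flip: ennreal_mult)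
    finally show ?thesis using True by simp
  qed simp
  have "fock_int 1 r f = (\<integral>\<^sup>+ z. ennreal (2 powr r) * ennreal ((fock_weighted 1 f z / 2) powr r) \<partial>lborel)"
    unfolding fock_int_eq by (intro nn_integral_cong) (simp add: powr_divide flip: ennreal_mult)
  also have "\<dots> = ennreal (2 powr r) * (\<integral>\<^sup>+ z. ennreal ((fock_weighted 1 f z / 2) powr r) \<partial>lborel)"
    by (rule nn_integral_cmult) simp
  also have "\<dots> \<le> ennreal (2 powr r) * (\<integral>\<^sup>+ z. \<integral>\<^sup>+ t. ennreal (?G (of_real t * z) * radial_kernel (cmod z) t)
      * indicator {0..1} t \<partial>lborel \<partial>lborel)"
    by (intro mult_left_mono nn_integral_mono fock_weighted_primitive_powr_le r f f0 hol) simp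
  also have "(\<integral>\<^sup>+ z. \<integral>\<^sup>+ t. ennreal (?G (of_real t * z) * radial_kernel (cmod z) t) * indicator {0..1} t \<partial>lborel \<partial>lborel)
      = (\<integral>\<^sup>+ z. \<integral>\<^sup>+ t. ennreal (?G (of_real t * z) * radial_kernel (cmod z) t) * indicator {0<..1} t \<partial>lborel \<partial>lborel)"
  \<comment> \<open>The endpoint \<open>t = 0\<close>, at which the scaling degenerates, is a null
    set.\<close>
  proof (rule nn_integral_cong, rule nn_integral_cong_AE)
    show "AE t in lborel. ennreal (?G (of_real t * z) * radial_kernel (cmod z) t) * indicator {0..1} t
        = ennreal (?G (of_real t * z) * radial_kernel (cmod z) t) * indicator {0<..1} t" for z
      using AE_lborel_singleton[of "0::real"] by eventually_elim (auto split: split_indicator)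
  qed
  also have "\<dots> = (\<integral>\<^sup>+ t. \<integral>\<^sup>+ z. ennreal (?G (of_real t * z) * radial_kernel (cmod z) t) * indicator {0<..1} t \<partial>lborel \<partial>lborel)"
    by (rule lborel_pair.Fubini'[symmetric]) measurable
  also have "\<dots> = (\<integral>\<^sup>+ t. (\<integral>\<^sup>+ z. ennreal (?G (of_real t * z) * radial_kernel (cmod z) t) \<partial>lborel) * indicator {0<..1} t \<partial>lborel)"
    by (intro nn_integral_cong nn_integral_multc) simp
  also have "\<dots> = (\<integral>\<^sup>+ t. \<integral>\<^sup>+ w. ennreal (?G w) * (ennreal (cmod w / t ^ 3 * exp (- cmod w * (1 / t - 1)))
      * indicator {0<..1} t) \<partial>lborel \<partial>lborel)" by (simp only: inner)
  also have "\<dots> = (\<integral>\<^sup>+ w. \<integral>\<^sup>+ t. ennreal (?G w) * (ennreal (cmod w / t ^ 3 * exp (- cmod w * (1 / t - 1)))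
      * indicator {0<..1} t) \<partial>lborel \<partial>lborel)"
    by (rule lborel_pair.Fubini') measurable
  also have "\<dots> = (\<integral>\<^sup>+ w. ennreal (?G w) * (\<integral>\<^sup>+ t. ennreal (cmod w / t ^ 3 * exp (- cmod w * (1 / t - 1)))
      * indicator {0<..1} t \<partial>lborel) \<partial>lborel)"
    by (intro nn_integral_cong nn_integral_cmult) simp
  also have "\<dots> \<le> (\<integral>\<^sup>+ w. ennreal 2 * ennreal (?G w) + ennreal (C powr r) * indicator (ball 0 1) w \<partial>lborel)"
  proof (rule nn_integral_mono)
    fix w
    have "ennreal (?G w) * (\<integral>\<^sup>+ t. ennreal (cmod w / t ^ 3 * exp (- cmod w * (1 / t - 1))) * indicator {0<..1} t \<partial>lborel)
        \<le> ennreal (?G w) * ennreal (1 + 1 / cmod w)"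
      by (intro mult_left_mono scaling_kernel_bound) auto
    also have "\<dots> = ennreal (?G w * (1 + 1 / cmod w))" by (simp add: ennreal_mult')
    also have "\<dots> \<le> ennreal (2 * ?G w + C powr r * indicator (ball 0 1) w)" by (intro ennreal_leI near)
    also have "\<dots> = ennreal 2 * ennreal (?G w) + ennreal (C powr r) * indicator (ball 0 1) w"
      by (simp add: ennreal_mult' split: split_indicator)
    finally show "ennreal (?G w) * (\<integral>\<^sup>+ t. ennreal (cmod w / t ^ 3 * exp (- cmod w * (1 / t - 1))) * indicator {0<..1} t \<partial>lborel)
        \<le> ennreal 2 * ennreal (?G w) + ennreal (C powr r) * indicator (ball 0 1) w" .
  qed
  also have "\<dots> = (\<integral>\<^sup>+ w. ennreal 2 * ennreal (?G w) \<partial>lborel)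
      + (\<integral>\<^sup>+ w. ennreal (C powr r) * indicator (ball (0::complex) 1) w \<partial>lborel)"
    by (rule nn_integral_add) simp_all
  also have "(\<integral>\<^sup>+ w. ennreal 2 * ennreal (?G w) \<partial>lborel) = ennreal 2 * fock_int 1 r g"
    unfolding fock_int_eq by (rule nn_integral_cmult) simp
  also have "(\<integral>\<^sup>+ w. ennreal (C powr r) * indicator (ball (0::complex) 1) w \<partial>lborel) = ennreal (C powr r) * ennreal pi"
    by (subst nn_integral_cmult_indicator) (simp_all add: emeasure_ball unit_ball_vol_2)
  finally have le: "fock_int 1 r f \<le> ennreal (2 powr r) * (ennreal 2 * fock_int 1 r g + ennreal (C powr r) * ennreal pi)"
    by (simp add: mult_left_mono)
  have "fock_int 1 r g < \<infinity>" using g r by (simp add: fock_space_def)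
  then have "ennreal (2 powr r) * (ennreal 2 * fock_int 1 r g + ennreal (C powr r) * ennreal pi) < \<infinity>"
    by (simp add: ennreal_mult_less_top)
  with le have "fock_int 1 r f < \<infinity>" by (rule le_less_trans)
  then show ?thesis using f_hol r by (simp add: fock_space_def)
qed

section \<open>Surjectivity for \<open>m = 1\<close> and the equivalence\<close>

text \<open>For the sup norm the subprobability kernel bounds the primitive by the norm of
  \<open>g\<close> itself. For finite exponents the area integral requires a function vanishing at
  0, so the constant is integrated separately.\<close>

lemma fock_space_1_subset_range_deriv:
  assumes p: "1 \<le> p"
  shows "fock_space 1 p \<subseteq> deriv ` fock_space 1 p"
proof
  fix g assume g: "g \<in> fock_space 1 p"
  have prim: "\<exists>f. (\<forall>z. (f has_field_derivative h z) (at z)) \<and> f 0 = 0" if h: "h \<in> fock_space 1 p" for h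
  proof -
    obtain F where F: "\<And>z. (F has_field_derivative h z) (at z)"
      using holomorphic_convex_primitive'[OF convex_UNIV open_UNIV fock_space_entire[OF h]] by auto
    have "((\<lambda>z. F z - F 0) has_field_derivative h z) (at z)" for z
      using DERIV_diff[OF F DERIV_const] by simp
    then show ?thesis by (intro exI[of _ "\<lambda>z. F z - F 0"]) simp
  qed
  from p show "g \<in> deriv ` fock_space 1 p"
  proof (cases rule: exponent_cases)
    case 1
    obtain f where f: "\<And>z. (f has_field_derivative g z) (at z)" "f 0 = 0" using prim[OF g] by blast
    define B where "B = fock_norm 1 \<infinity> g"
    have B: "0 \<le> B" by (simp add: B_def fock_norm_nonneg)
    have [measurable]: "radial_kernel \<rho> \<in> borel_measurable borel" for \<rho>
      unfolding radial_kernel_def[abs_def] by measurable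
    have f_hol: "f holomorphic_on UNIV" unfolding holomorphic_on_open[OF open_UNIV] using f(1) by auto
    have "fock_weighted 1 f z \<le> B" for z
    proof -
      have "ennreal (fock_weighted 1 f z)
        \<le> (\<integral>\<^sup>+ t. ennreal (fock_weighted 1 g (of_real t * z) * radial_kernel (cmod z) t) * indicator {0..1} t \<partial>lborel)"
        by (rule fock_weighted_primitive_le[OF f fock_space_entire[OF g]])
      also have "\<dots> \<le> (\<integral>\<^sup>+ t. ennreal B * (ennreal (radial_kernel (cmod z) t) * indicator {0..1} t) \<partial>lborel)"
      proof (rule nn_integral_mono)
        fix t
        have "fock_weighted 1 g (of_real t * z) * radial_kernel (cmod z) t \<le> B * radial_kernel (cmod z) t"
          unfolding B_def using g 1 by (intro mult_right_mono fock_weighted_le_norm radial_kernel_nonneg) auto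
        then show "ennreal (fock_weighted 1 g (of_real t * z) * radial_kernel (cmod z) t) * indicator {0..1} t
            \<le> ennreal B * (ennreal (radial_kernel (cmod z) t) * indicator {0..1} t)"
          using B by (auto simp: radial_kernel_nonneg ennreal_leI split: split_indicator simp flip: ennreal_mult)
      qed
      also have "\<dots> = ennreal B * (\<integral>\<^sup>+ t. ennreal (radial_kernel (cmod z) t) * indicator {0..1} t \<partial>lborel)"
        by (rule nn_integral_cmult) simp
      also have "\<dots> \<le> ennreal B * 1" by (intro mult_left_mono nn_integral_radial_kernel_le_1) auto
      finally show ?thesis using B by (simp add: ennreal_le_iff)
    qed
    from fock_spaceI_sup(1)[OF f_hol this] 1 have "f \<in> fock_space 1 p" by simp
    moreover have "g = deriv f" using DERIV_imp_deriv[OF f(1)] by auto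
    ultimately show ?thesis by blast
  next
    case (2 r)
    \<comment> \<open>The primitive of the removed constant is the monomial \<open>g 0 * z\<close>,
      which lies in the space and is added back at the end.\<close>
    define h where "h z = g z - g 0" for z
    have h: "h \<in> fock_space 1 p" unfolding h_def by (intro fock_space_diff p g fock_space_const) simp
    obtain f where f: "\<And>z. (f has_field_derivative h z) (at z)" "f 0 = 0" using prim[OF h] by blast
    have "f \<in> fock_space 1 p"
      using primitive_in_fock_space_finite[OF 2(1) h[unfolded 2(2)] _ f] by (simp add: h_def 2(2))
    moreover have "(\<lambda>z. g 0 * z) \<in> fock_space 1 p"
      using fock_norm_cmult(1)[OF p monomial_in_fock_space[OF p, of 1 1], of "g 0"] by simp
    ultimately have "(\<lambda>z. f z + g 0 * z) \<in> fock_space 1 p" by (rule fock_norm_add(1)[OF p])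
    moreover have "deriv (\<lambda>z. f z + g 0 * z) = g"
      by (rule ext, rule DERIV_imp_deriv) (auto intro!: derivative_eq_intros f(1) simp: h_def)
    ultimately show ?thesis
      using image_eqI[of g deriv "\<lambda>z. f z + g 0 * z" "fock_space 1 p"] by simp
  qed
qed

theorem theorem1p3:
  fixes p q :: ennreal and m :: real
  assumes "1 \<le> p" and "1 \<le> q" and "0 < m"
    and "D_bounded m p q"
  shows "(D_closed_range m p q \<longleftrightarrow> p = q \<and> m = 1) \<and>
         (p = q \<and> m = 1 \<longleftrightarrow> D_surjective m p q)"
proof -
  have closed_imp: "p = q \<and> m = 1" if closed: "D_closed_range m p q"
  proof -
    obtain K where K: "0 < K"
      "\<And>f. f \<in> fock_space m p \<Longrightarrow> f 0 = 0 \<Longrightarrow> fock_norm m p f \<le> K * fock_norm m q (deriv f)"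
      using D_closed_range_lower_bound[OF assms closed] by metis
    have "p = q" by (rule exponents_eq_of_two_sided[OF assms K])
    then show ?thesis using exponent_eq_1_of_two_sided[of p m K] assms K by simp
  qed
  moreover have "D_surjective m p q" if "p = q \<and> m = 1"
    using that assms fock_space_1_subset_range_deriv[of p]
    by (auto simp: D_surjective_def D_bounded_def)
  \<comment> \<open>A surjective D has the whole space as its range, and that is closed in its own
    topology.\<close>
  moreover have "D_closed_range m p q" if "D_surjective m p q"
  proof -
    interpret Metric_space "fock_space m q" "fock_dist m q" by (rule Metric_space_fock[OF assms(2)])
    show ?thesis
      using that closedin_topspace[of mtopology]
      by (simp add: D_closed_range_def D_surjective_def fock_topology_def)
  qed
  ultimately show ?thesis by blast
qed

end
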